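(* Let $G$ be a locally compact group, let $(\xi_k)_{k\in\mathbb{Z}}$ be $G$-valued random variables with common law $\mu$, and let $\phi$ be an automorphism of $G$. Then there is a solution $(\eta_k)$ of the equation $$\eta_k=\xi_k\,\phi(\eta_{k-1}),\qquad k\in\mathbb{Z},$$ if and only if the probability measure $\rho=1\otimes\mu$ on $\tilde G=\mathbb{Z}\ltimes_\phi G$ is not dissipating.
   Context: Locally compact groups are Hausdorff topological groups; automorphisms are topological group automorphisms; probability measures are regular Borel probability measures. For a probability measure $\mu$ on a locally compact group: $\phi(\mu)(E)=\mu(\phi^{-1}(E))$ for Borel $E$; convolution is $\mu*\lambda(E)=\int\mu(Ex^{-1})\,d\lambda(x)$; $\mu^n$ is the $n$-th convolution power. Solutions: in the equation $\eta_k=\xi_k\phi(\eta_{k-1})$, the noise variables $\xi_k$ are given, the $\eta_k$ are unknown $G$-valued random variables, and it is always required that $\xi_k$ be independent of $\eta_j$ for all $j<k$. Solutions are studied through their laws: a solution is identified with the sequence $(\lambda_k)_{k\in\mathbb{Z}}$ of probability measures on $G$ ($\lambda_k$ the law of $\eta_k$) satisfying the corresponding convolution equation $\lambda_k=\mu*\phi(\lambda_{k-1})$ for all $k\in\mathbb{Z}$. The semidirect product $\mathbb{Z}\ltimes_\phi G$ is the set $\mathbb{Z}\times G$ with product $(n,g)(m,h)=(n+m,\,g\phi^n(h))$; it is a locally compact group (product topology, $\mathbb{Z}$ discrete) with $G$ as an open subgroup. The measure $1\otimes\mu$ on it is defined by $(1\otimes\mu)(A\times B)=\delta_1(A)\mu(B)$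 for $A\subseteq\mathbb{Z}$ and $B\subseteq G$ Borel. A probability measure $\mu$ on a locally compact group $H$ is dissipating if for every compact set $C\subseteq H$, $\sup_{x\in H}\mu^n(Cx)\to 0$ as $n\to\infty$. *)

theory Defs
  imports "HOL-Probability.Probability" "HOL-Algebra.Coset"
begin

locale locally_compact_group = group G for G (structure) +
  fixes T :: "'a topology"
  assumes topspace_eq: "topspace T = carrier G"
    and continuous_mult: "continuous_map (prod_topology T T) T (\<lambda>(x, y). x \<otimes> y)"
    and continuous_inv: "continuous_map T T (\<lambda>x. inv x)"
    and Hausdorff: "Hausdorff_space T"
    and locally_compact: "locally_compact_space T"

definition topological_automorphism ::
  "('a, 'b) monoid_scheme \<Rightarrow> 'a topology \<Rightarrow> ('a \<Rightarrow> 'a) \<Rightarrow> bool"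
  where "topological_automorphism G T \<phi> \<longleftrightarrow> \<phi> \<in> iso G G \<and> homeomorphic_map T T \<phi>"

definition borel_of :: "'a topology \<Rightarrow> 'a measure"
  where "borel_of T = sigma (topspace T) {U. openin T U}"

definition regular_borel_prob :: "'a topology \<Rightarrow> 'a measure \<Rightarrow> bool"
  where "regular_borel_prob T \<mu> \<longleftrightarrow>
    prob_space \<mu> \<and> sets \<mu> = sets (borel_of T) \<and>
    (\<forall>E\<in>sets \<mu>.
      emeasure \<mu> E = (INF U\<in>{U. openin T U \<and> E \<subseteq> U}. emeasure \<mu> U) \<and>
      emeasure \<mu> E = (SUP K\<in>{K. compactin T K \<and> K \<subseteq> E}. emeasure \<mu> K))"

(* Defined through the integral formula rather than as the image of a product measure:
   without second countability the multiplication need not be measurable for the product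
   of the Borel sigma-algebras. *)
definition group_convolution ::
  "('a, 'b) monoid_scheme \<Rightarrow> 'a topology \<Rightarrow> 'a measure \<Rightarrow> 'a measure \<Rightarrow> 'a measure"
  where "group_convolution G T \<mu> \<nu> =
    measure_of (topspace T) (sets (borel_of T))
      (\<lambda>E. \<integral>\<^sup>+ x. emeasure \<mu> (E #>\<^bsub>G\<^esub> inv\<^bsub>G\<^esub> x) \<partial>\<nu>)"

primrec convolution_power ::
  "('a, 'b) monoid_scheme \<Rightarrow> 'a topology \<Rightarrow> 'a measure \<Rightarrow> nat \<Rightarrow> 'a measure"
  where
    "convolution_power G T \<mu> 0 = return (borel_of T) \<one>\<^bsub>G\<^esub>"
  | "convolution_power G T \<mu> (Suc n) = group_convolution G T (convolution_power G T \<mu> n) \<mu>"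

definition dissipating :: "('a, 'b) monoid_scheme \<Rightarrow> 'a topology \<Rightarrow> 'a measure \<Rightarrow> bool"
  where "dissipating H T \<mu> \<longleftrightarrow>
    (\<forall>C. compactin T C \<longrightarrow>
      (\<lambda>n. SUP x\<in>carrier H. emeasure (convolution_power H T \<mu> n) (C #>\<^bsub>H\<^esub> x))
        \<longlonglongrightarrow> 0)"

(* A solution is identified with the sequence of laws of its terms; the convolution
   equation expresses that the noise at time k, of law mu, is independent of the term at
   time k - 1. *)
definition is_solution ::
  "('a, 'b) monoid_scheme \<Rightarrow> 'a topology \<Rightarrow> ('a \<Rightarrow> 'a) \<Rightarrow> 'a measure \<Rightarrow> (int \<Rightarrow> 'a measure) \<Rightarrow> bool"
  where "is_solution G T \<phi> \<mu> \<Lambda> \<longleftrightarrow>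
    (\<forall>k. regular_borel_prob T (\<Lambda> k)) \<and>
    (\<forall>k. \<Lambda> k = group_convolution G T \<mu> (distr (\<Lambda> (k - 1)) (borel_of T) \<phi>))"

definition aut_power :: "('a, 'b) monoid_scheme \<Rightarrow> ('a \<Rightarrow> 'a) \<Rightarrow> int \<Rightarrow> 'a \<Rightarrow> 'a"
  where "aut_power G \<phi> n =
    (if 0 \<le> n then \<phi> ^^ nat n else inv_into (carrier G) \<phi> ^^ nat (- n))"

definition Z_semidirect :: "('a, 'b) monoid_scheme \<Rightarrow> ('a \<Rightarrow> 'a) \<Rightarrow> (int \<times> 'a) monoid"
  where "Z_semidirect G \<phi> =
    \<lparr>carrier = UNIV \<times> carrier G,
     monoid.mult = (\<lambda>(n, g) (m, h). (n + m, g \<otimes>\<^bsub>G\<^esub> aut_power G \<phi> n h)),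
     one = (0, \<one>\<^bsub>G\<^esub>)\<rparr>"

definition Z_semidirect_topology :: "'a topology \<Rightarrow> (int \<times> 'a) topology"
  where "Z_semidirect_topology T = prod_topology (discrete_topology UNIV) T"

(* As the integers are countable and discrete, the product sigma-algebra here is the Borel
   sigma-algebra of Z_semidirect_topology. *)
definition one_tensor :: "'a measure \<Rightarrow> (int \<times> 'a) measure"
  where "one_tensor \<mu> = return (count_space UNIV) 1 \<Otimes>\<^sub>M \<mu>"

end

theory Submission
  imports Defs
begin

text \<open>
  A law of the random element at time \<open>k\<close> is placed on the level \<open>{k} \<times> G\<close> of the semidirect
  product \<open>H = \<int> \<ltimes> G\<close>. There the equation \<open>\<lambda>\<^sub>k = \<mu> * \<phi>(\<lambda>\<^sub>k\<^sub>-\<^sub>1)\<close> becomes \<open>\<lambda>\<^sub>k = \<rho> * \<lambda>\<^sub>k\<^sub>-\<^sub>1\<close>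
  with \<open>\<rho> = 1 \<otimes> \<mu>\<close>, in which the automorphism no longer occurs. The heart of the matter is
  therefore a statement about one locally compact group \<open>H\<close> and one probability measure \<open>\<rho>\<close>:
  it is not dissipating if and only if there is a two-sided sequence of nonzero measures of
  mass at most one with \<open>\<lambda>\<^sub>k = \<rho> * \<lambda>\<^sub>k\<^sub>-\<^sub>1\<close> for all \<open>k\<close> (called \<open>invariant_chain\<close> below).

  If such a chain exists, then \<open>\<lambda>\<^sub>0 = \<rho>\<^sup>n * \<lambda>\<^sub>-\<^sub>n\<close>, so for compact \<open>K\<close> the number \<open>\<lambda>\<^sub>0(K)\<close> is
  the integral of \<open>\<rho>\<^sup>n(Kx\<^sup>-\<^sup>1)\<close> over \<open>x\<close> against a measure of mass at most one and bounds the
  supremum of these values from below, for every \<open>n\<close>; choosing \<open>K\<close> with \<open>\<lambda>\<^sub>0(K) > 0\<close> shows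
  that \<open>\<rho>\<close> is not dissipating (\<open>invariant_chain_imp_not_dissipating\<close>).

  Conversely, the suprema \<open>sup\<^sub>x \<rho>\<^sup>n(Cx)\<close> decrease in \<open>n\<close>. If they do not tend to 0 for some
  compact \<open>C\<close>, there are a constant \<open>a > 0\<close> and points \<open>x\<^sub>n\<close> with \<open>\<rho>\<^sup>n(Cx\<^sub>n) > a\<close> for all \<open>n\<close>.
  Start a chain at time \<open>-n\<close> in the point \<open>x\<^sub>n\<^sup>-\<^sup>1\<close>: the measures \<open>\<rho>\<^sup>n\<^sup>+\<^sup>k * \<delta>(x\<^sub>n\<^sup>-\<^sup>1)\<close>
  satisfy the equation for all times \<open>k > -n\<close>, and the one at time 0 gives \<open>C\<close> mass more than
  \<open>a\<close>. Let \<open>n \<rightarrow> \<infinity>\<close> along an ultrafilter and take vague limits. Convolution by the fixed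
  measure \<open>\<rho>\<close> is vaguely continuous (\<open>vague_limit_conv\<close>), so the limits satisfy the equation
  at all times, and the limit at time 0 gives \<open>C\<close> mass at least \<open>a\<close>
  (\<open>not_dissipating_imp_invariant_chain\<close>). Mass may escape to infinity in the limit, but no
  tightness is needed: all limits have one and the same positive mass and may be normalised at
  the end.

  The group need not be second countable. Vague limits are described by inequalities on open
  and on compact sets, and are constructed from the content \<open>K \<mapsto> lim \<alpha>\<^sub>n(K)\<close> on compact sets
  (\<open>radon_extension\<close>, \<open>ex_vague_limit\<close>). Measurability of \<open>x \<mapsto> \<mu>(Ex\<^sup>-\<^sup>1)\<close> comes from the
  semicontinuity that regularity of \<open>\<mu>\<close> provides for open \<open>E\<close>; it makes convolution a bind of
  the Giry monad and thereby associative (\<open>conv_eq_bind\<close>, \<open>conv_assoc\<close>).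
\<close>

section \<open>Borel sets and Radon measures\<close>

lemma space_borel_of [simp]: "space (borel_of T) = topspace T"
  unfolding borel_of_def by (rule space_measure_of) (auto dest: openin_subset)

lemma sets_borel_of: "sets (borel_of T) = sigma_sets (topspace T) {U. openin T U}"
  unfolding borel_of_def by (rule sets_measure_of) (auto dest: openin_subset)

lemma openin_sets_borel_of: "openin T U \<Longrightarrow> U \<in> sets (borel_of T)"
  by (auto simp: sets_borel_of)

lemma closedin_sets_borel_of: "closedin T C \<Longrightarrow> C \<in> sets (borel_of T)"
  using sets.compl_sets[OF openin_sets_borel_of[of T "topspace T - C"]]
  by (simp add: closedin_def double_diff)

lemma compactin_sets_borel_of:
  "Hausdorff_space T \<Longrightarrow> compactin T K \<Longrightarrow> K \<in> sets (borel_of T)"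
  by (simp add: closedin_sets_borel_of compactin_imp_closedin)

lemma continuous_map_measurable_borel_of:
  assumes "continuous_map S T f"
  shows "f \<in> borel_of S \<rightarrow>\<^sub>M borel_of T"
  unfolding borel_of_def[of T]
proof (rule measurable_sigma_sets[OF _ _ _])
  show "{U. openin T U} \<subseteq> Pow (topspace T)" by (auto dest: openin_subset)
  show "f \<in> space (borel_of S) \<rightarrow> topspace T"
    using assms by (simp add: continuous_map_funspace)
  show "f -` U \<inter> space (borel_of S) \<in> sets (borel_of S)" if "U \<in> {U. openin T U}" for U
  proof -
    have "openin S {x \<in> topspace S. f x \<in> U}"
      using that assms by (auto simp: openin_continuous_map_preimage)
    moreover have "f -` U \<inter> space (borel_of S) = {x \<in> topspace S. f x \<in> U}" by auto
    ultimately show ?thesis by (simp add: openin_sets_borel_of)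
  qed
  show "sets (sigma (topspace T) {U. openin T U}) = sigma_sets (topspace T) {U. openin T U}"
    by (rule sets_measure_of) (auto dest: openin_subset)
qed

text \<open>
  Only the mass of open sets is required to be approximated from inside; for Hausdorff spaces
  the regularity of all Borel sets follows (\<open>radon_subprob_approx\<close>). Masses below one are
  admitted because vague limits of probability measures may lose mass.
\<close>

definition radon_subprob :: "'a topology \<Rightarrow> 'a measure \<Rightarrow> bool" where
  "radon_subprob T M \<longleftrightarrow>
    sets M = sets (borel_of T) \<and> emeasure M (topspace T) \<le> 1 \<and>
    (\<forall>U. openin T U \<longrightarrow>
      emeasure M U = (SUP K\<in>{K. compactin T K \<and> K \<subseteq> U}. emeasure M K))"

lemma radon_subprob_sets: "radon_subprob T M \<Longrightarrow> sets M = sets (borel_of T)"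
  by (simp add: radon_subprob_def)

lemma radon_subprob_space: "radon_subprob T M \<Longrightarrow> space M = topspace T"
  using sets_eq_imp_space_eq[of M "borel_of T"] by (simp add: radon_subprob_def)

lemma radon_subprob_le_1: "radon_subprob T M \<Longrightarrow> emeasure M E \<le> 1"
  using emeasure_space[of M E] radon_subprob_space[of T M]
  by (auto simp: radon_subprob_def intro: order_trans)

lemma radon_subprob_finite: "radon_subprob T M \<Longrightarrow> finite_measure M"
  using radon_subprob_le_1[of T M "space M"] by (intro finite_measureI) (auto simp: top_unique)

lemma radon_subprob_neq_top: "radon_subprob T M \<Longrightarrow> emeasure M E \<noteq> \<top>"
  using radon_subprob_le_1[of T M E] by (auto simp: top_unique)

lemma radon_subprobI:
  assumes "sets M = sets (borel_of T)" "emeasure M (topspace T) \<le> 1"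
    and approx: "\<And>U e. openin T U \<Longrightarrow> 0 < e \<Longrightarrow>
      \<exists>K. compactin T K \<and> K \<subseteq> U \<and> emeasure M U \<le> emeasure M K + ennreal e"
  shows "radon_subprob T M"
  unfolding radon_subprob_def
proof (safe intro!: assms(1,2))
  fix U assume U: "openin T U"
  have U_sets: "U \<in> sets M" using U assms by (simp add: openin_sets_borel_of)
  have "(SUP K\<in>{K. compactin T K \<and> K \<subseteq> U}. emeasure M K) \<le> emeasure M U"
    using U_sets by (auto intro!: SUP_least emeasure_mono)
  moreover have "emeasure M U \<le> (SUP K\<in>{K. compactin T K \<and> K \<subseteq> U}. emeasure M K)"
  proof (rule ennreal_le_epsilon)
    fix e :: real assume "0 < e"
    then obtain K where K: "compactin T K" "K \<subseteq> U" "emeasure M U \<le> emeasure M K + ennreal e"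
      using approx[OF U] by blast
    have "emeasure M K \<le> (SUP K\<in>{K. compactin T K \<and> K \<subseteq> U}. emeasure M K)"
      using K by (intro SUP_upper) auto
    then show "emeasure M U \<le> (SUP K\<in>{K. compactin T K \<and> K \<subseteq> U}. emeasure M K) + ennreal e"
      using K(3) by (meson add_right_mono order_trans)
  qed
  ultimately show "emeasure M U = (SUP K\<in>{K. compactin T K \<and> K \<subseteq> U}. emeasure M K)"
    by (rule antisym[rotated])
qed

lemma radon_subprob_open_approx:
  assumes M: "radon_subprob T M" and U: "openin T U" and "0 < (e::real)"
  obtains K where "compactin T K" "K \<subseteq> U" "emeasure M U \<le> emeasure M K + ennreal e"
proof -
  have "\<exists>K\<in>{K. compactin T K \<and> K \<subseteq> U}. emeasure M U < emeasure M K + ennreal e"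
    by (rule SUP_approx_ennreal[OF \<open>0 < e\<close>])
      (use M U radon_subprob_neq_top[OF M, of U] in \<open>auto simp: radon_subprob_def\<close>)
  then show ?thesis using that by (auto intro: less_imp_le)
qed

lemma radon_subprob_open_approx_diff:
  assumes T: "Hausdorff_space T" and M: "radon_subprob T M"
    and U: "openin T U" and "0 < (e::real)"
  obtains K where "compactin T K" "K \<subseteq> U" "emeasure M (U - K) \<le> ennreal e"
proof -
  obtain K where K: "compactin T K" "K \<subseteq> U" "emeasure M U \<le> emeasure M K + ennreal e"
    using radon_subprob_open_approx[OF M U \<open>0 < e\<close>] .
  have sets: "K \<in> sets M" "U \<in> sets M"
    using M K U T by (auto simp: radon_subprob_sets[OF M] openin_sets_borel_of compactin_sets_borel_of)
  have "emeasure M (U - K) = emeasure M U - emeasure M K"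
    using radon_subprob_neq_top[OF M, of K] by (intro emeasure_Diff sets K(2)) simp
  also have "\<dots> \<le> ennreal e"
    using K(3) radon_subprob_neq_top[OF M, of K] by (simp add: ennreal_minus_le_iff)
  finally show ?thesis using that K by blast
qed

text \<open>
  The Borel sets that can be squeezed between a closed and an open set of nearly the same
  measure form a \<open>\<sigma>\<close>-algebra: complements exchange the two roles, and of a countable union of
  closed sets a finite part has nearly the full measure. Compact sets could not be used in
  place of closed ones here, as they are not stable under complements.
\<close>

lemma radon_subprob_closed_open_approx:
  assumes T: "Hausdorff_space T" and M: "radon_subprob T M"
    and E: "E \<in> sets (borel_of T)" and "0 < (e::real)"
  shows "\<exists>C U. closedin T C \<and> openin T U \<and> C \<subseteq> E \<and> E \<subseteq> U \<and> emeasure M (U - C) \<le> ennreal e"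
  using E[unfolded sets_borel_of] \<open>0 < e\<close>
proof (induction arbitrary: e)
  case (Basic U)
  then have U: "openin T U" by simp
  obtain K where "compactin T K" "K \<subseteq> U" "emeasure M (U - K) \<le> ennreal e"
    using radon_subprob_open_approx_diff[OF T M U Basic(2)] .
  then show ?case using U compactin_imp_closedin[OF T] by blast
next
  case Empty
  show ?case by (rule exI[of _ "{}"], rule exI[of _ "{}"]) simp
next
  case (Compl A)
  obtain C U where CU: "closedin T C" "openin T U" "C \<subseteq> A" "A \<subseteq> U"
    "emeasure M (U - C) \<le> ennreal e" using Compl.IH[OF Compl.prems] by blast
  have "(topspace T - C) - (topspace T - U) = U - C"
    using CU(2) by (auto dest: openin_subset)
  then have "emeasure M ((topspace T - C) - (topspace T - U)) \<le> ennreal e"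
    using CU(5) by simp
  moreover have "closedin T (topspace T - U)" "openin T (topspace T - C)"
    "topspace T - U \<subseteq> topspace T - A" "topspace T - A \<subseteq> topspace T - C"
    using CU by auto
  ultimately show ?case by blast
next
  case (Union A)
  \<comment> \<open>The errors on the individual sets add up to \<open>e / 2\<close>; this leaves room for passing to finitely many \<open>C i\<close>.\<close>
  define d where "d i = (e / 2) * (1/2) ^ Suc i" for i :: nat
  have d: "0 < d i" for i
    using Union.prems by (simp add: d_def)
  have "d sums (e / 2 * 1)"
    unfolding d_def by (intro sums_mult power_half_series)
  then have d_sum: "(\<Sum>i. ennreal (d i)) = ennreal (e / 2)"
    using d by (intro suminf_ennreal_eq) (auto intro: less_imp_le)
  have "\<exists>C U. closedin T C \<and> openin T U \<and> C \<subseteq> A i \<and> A i \<subseteq> U \<and> emeasure M (U - C) \<le> ennreal (d i)" for i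
    using Union.IH[of "d i" i] d by blast
  then obtain C U where CU: "\<And>i. closedin T (C i)" "\<And>i. openin T (U i)" "\<And>i. C i \<subseteq> A i"
    "\<And>i. A i \<subseteq> U i" "\<And>i. emeasure M (U i - C i) \<le> ennreal (d i)" by metis
  let ?U = "\<Union>i. U i" and ?C = "\<lambda>n. \<Union>i\<le>n. C i"
  have sets: "C i \<in> sets M" "U i \<in> sets M" for i
    using CU M by (auto simp: radon_subprob_sets[OF M] openin_sets_borel_of closedin_sets_borel_of)
  have "(\<lambda>n. emeasure M (?U - ?C n)) \<longlonglongrightarrow> emeasure M (\<Inter>n. ?U - ?C n)"
  proof (rule Lim_emeasure_decseq)
    show "range (\<lambda>n. ?U - ?C n) \<subseteq> sets M"
      using sets by (auto intro!: sets.Diff sets.countable_UN)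
    show "decseq (\<lambda>n. ?U - ?C n)" by (intro monotoneI) force
  qed (simp add: radon_subprob_neq_top[OF M])
  moreover have "emeasure M (\<Inter>n. ?U - ?C n) < ennreal e"
  proof -
    have "(\<Inter>n. ?U - ?C n) \<subseteq> (\<Union>i. U i - C i)" by fastforce
    then have "emeasure M (\<Inter>n. ?U - ?C n) \<le> emeasure M (\<Union>i. U i - C i)"
      by (rule emeasure_mono) (use sets in auto)
    also have "\<dots> \<le> (\<Sum>i. emeasure M (U i - C i))"
      by (rule emeasure_subadditive_countably) (use sets in auto)
    also have "\<dots> \<le> (\<Sum>i. ennreal (d i))" by (rule suminf_le) (use CU in auto)
    also have "\<dots> = ennreal (e / 2)" by (rule d_sum)
    also have "\<dots> < ennreal e" using Union.prems by (simp add: ennreal_lessI)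
    finally show ?thesis .
  qed
  ultimately have "\<forall>\<^sub>F n in sequentially. emeasure M (?U - ?C n) < ennreal e"
    by (rule order_tendstoD)
  then obtain n where "emeasure M (?U - ?C n) < ennreal e" by (auto simp: eventually_sequentially)
  then have "emeasure M (?U - ?C n) \<le> ennreal e" by (rule less_imp_le)
  moreover have "closedin T (?C n)" "openin T ?U" "?C n \<subseteq> (\<Union>i. A i)" "(\<Union>i. A i) \<subseteq> ?U"
    using CU(1,2) by (auto intro!: closedin_Union) (use CU(3,4) in blast)+
  ultimately show ?case by blast
qed

text \<open>
  The whole space is open, hence up to a small error compact, and intersecting a closed set
  with that compact set gives a compact set.
\<close>

lemma radon_subprob_approx:
  assumes T: "Hausdorff_space T" and M: "radon_subprob T M"
    and E: "E \<in> sets (borel_of T)" and "0 < (e::real)"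
  obtains K U where "compactin T K" "openin T U" "K \<subseteq> E" "E \<subseteq> U" "emeasure M (U - K) \<le> ennreal e"
proof -
  have e2: "0 < e / 2" using \<open>0 < e\<close> by simp
  obtain C U where CU: "closedin T C" "openin T U" "C \<subseteq> E" "E \<subseteq> U" "emeasure M (U - C) \<le> ennreal (e / 2)"
    using radon_subprob_closed_open_approx[OF T M E e2] by blast
  obtain K where K: "compactin T K" "K \<subseteq> topspace T" "emeasure M (topspace T - K) \<le> ennreal (e / 2)"
    using radon_subprob_open_approx_diff[OF T M openin_topspace e2] .
  have sets: "C \<in> sets M" "U \<in> sets M" "K \<in> sets M" "topspace T \<in> sets M"
    using CU K M T by (auto simp: radon_subprob_sets[OF M] openin_sets_borel_of closedin_sets_borel_of compactin_sets_borel_of)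
  have "emeasure M (U - C \<inter> K) \<le> emeasure M ((U - C) \<union> (topspace T - K))"
    using CU by (intro emeasure_mono) (use sets openin_subset[OF CU(2)] in auto)
  also have "\<dots> \<le> emeasure M (U - C) + emeasure M (topspace T - K)"
    by (rule emeasure_subadditive) (use sets in auto)
  also have "\<dots> \<le> ennreal (e / 2) + ennreal (e / 2)" by (intro add_mono CU K)
  also have "\<dots> = ennreal e" using \<open>0 < e\<close> by (simp flip: ennreal_plus)
  finally show ?thesis
    using CU K by (intro that[of "C \<inter> K" U]) (auto intro: closed_Int_compactin)
qed

lemma radon_subprob_inner_approx:
  assumes T: "Hausdorff_space T" and M: "radon_subprob T M"
    and E: "E \<in> sets (borel_of T)" and "0 < (e::real)"
  obtains K where "compactin T K" "K \<subseteq> E" "emeasure M E \<le> emeasure M K + ennreal e"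
proof -
  obtain K U where KU: "compactin T K" "openin T U" "K \<subseteq> E" "E \<subseteq> U" "emeasure M (U - K) \<le> ennreal e"
    using radon_subprob_approx[OF assms] .
  have sets: "K \<in> sets M" "U \<in> sets M" "E \<in> sets M"
    using KU T E by (auto simp: radon_subprob_sets[OF M] openin_sets_borel_of compactin_sets_borel_of)
  have "emeasure M E \<le> emeasure M (K \<union> (U - K))"
    using KU sets by (intro emeasure_mono) auto
  also have "\<dots> \<le> emeasure M K + emeasure M (U - K)"
    using sets by (intro emeasure_subadditive) auto
  also have "\<dots> \<le> emeasure M K + ennreal e" using KU by (intro add_left_mono)
  finally show ?thesis using KU that by blast
qed

lemma radon_subprob_outer_approx:
  assumes T: "Hausdorff_space T" and M: "radon_subprob T M"
    and E: "E \<in> sets (borel_of T)" and "0 < (e::real)"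
  obtains U where "openin T U" "E \<subseteq> U" "emeasure M U \<le> emeasure M E + ennreal e"
proof -
  obtain K U where KU: "compactin T K" "openin T U" "K \<subseteq> E" "E \<subseteq> U" "emeasure M (U - K) \<le> ennreal e"
    using radon_subprob_approx[OF assms] .
  have sets: "K \<in> sets M" "U \<in> sets M" "E \<in> sets M"
    using KU T E by (auto simp: radon_subprob_sets[OF M] openin_sets_borel_of compactin_sets_borel_of)
  have "emeasure M U \<le> emeasure M (E \<union> (U - K))"
    using KU sets by (intro emeasure_mono) auto
  also have "\<dots> \<le> emeasure M E + emeasure M (U - K)"
    using sets by (intro emeasure_subadditive) auto
  also have "\<dots> \<le> emeasure M E + ennreal e" using KU by (intro add_left_mono)
  finally show ?thesis using KU that by blast
qed

lemma radon_subprob_leI: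
  assumes T: "Hausdorff_space T" and M: "radon_subprob T M" and N: "radon_subprob T N"
    and le: "\<And>K. compactin T K \<Longrightarrow> emeasure M K \<le> emeasure N K"
    and E: "E \<in> sets (borel_of T)"
  shows "emeasure M E \<le> emeasure N E"
proof (rule ennreal_le_epsilon)
  fix e :: real assume "0 < e"
  obtain K where K: "compactin T K" "K \<subseteq> E" "emeasure M E \<le> emeasure M K + ennreal e"
    using radon_subprob_inner_approx[OF T M E \<open>0 < e\<close>] .
  note K(3)
  also have "emeasure M K \<le> emeasure N K" by (rule le[OF K(1)])
  also have "emeasure N K \<le> emeasure N E"
    using K E by (intro emeasure_mono) (auto simp: radon_subprob_sets[OF N])
  finally show "emeasure M E \<le> emeasure N E + ennreal e" by (simp add: add_right_mono)
qed

lemma radon_subprob_eqI: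
  assumes T: "Hausdorff_space T" and M: "radon_subprob T M" and N: "radon_subprob T N"
    and eq: "\<And>K. compactin T K \<Longrightarrow> emeasure M K = emeasure N K"
  shows "M = N"
proof (rule measure_eqI)
  show "sets M = sets N" by (simp add: radon_subprob_sets[OF M] radon_subprob_sets[OF N])
  fix E assume "E \<in> sets M"
  then have E: "E \<in> sets (borel_of T)" by (simp add: radon_subprob_sets[OF M])
  show "emeasure M E = emeasure N E"
    by (rule antisym; rule radon_subprob_leI[OF T _ _ _ E]) (simp_all add: M N eq)
qed

lemma regular_borel_prob_iff_radon_subprob:
  assumes T: "Hausdorff_space T"
  shows "regular_borel_prob T M \<longleftrightarrow> radon_subprob T M \<and> emeasure M (topspace T) = 1"
    (is "?L \<longleftrightarrow> ?R")
proof
  assume L: ?L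
  then have sets: "sets M = sets (borel_of T)" by (simp add: regular_borel_prob_def)
  have "space M = topspace T" using sets_eq_imp_space_eq[OF sets] by simp
  moreover have "prob_space M" using L by (simp add: regular_borel_prob_def)
  ultimately have "emeasure M (topspace T) = 1" using prob_space.emeasure_space_1 by metis
  then show ?R
    using L sets openin_sets_borel_of[of T]
    unfolding radon_subprob_def regular_borel_prob_def by (metis order_refl)
next
  assume R: ?R
  then have M: "radon_subprob T M" by simp
  note sets = radon_subprob_sets[OF M]
  have "prob_space M" using R by (intro prob_spaceI) (simp add: radon_subprob_space[OF M])
  moreover have "emeasure M E = (INF U\<in>{U. openin T U \<and> E \<subseteq> U}. emeasure M U)" if E: "E \<in> sets M" for E
  proof (rule antisym)
    show "emeasure M E \<le> (INF U\<in>{U. openin T U \<and> E \<subseteq> U}. emeasure M U)"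
      by (auto intro!: INF_greatest emeasure_mono simp: sets openin_sets_borel_of)
    show "(INF U\<in>{U. openin T U \<and> E \<subseteq> U}. emeasure M U) \<le> emeasure M E"
    proof (rule ennreal_le_epsilon)
      fix e :: real assume "0 < e"
      then obtain U where U: "openin T U" "E \<subseteq> U" "emeasure M U \<le> emeasure M E + ennreal e"
        using radon_subprob_outer_approx[OF T M E[unfolded sets]] by blast
      have "(INF U\<in>{U. openin T U \<and> E \<subseteq> U}. emeasure M U) \<le> emeasure M U"
        using U by (intro INF_lower) auto
      with U(3) show "(INF U\<in>{U. openin T U \<and> E \<subseteq> U}. emeasure M U) \<le> emeasure M E + ennreal e"
        by (rule order_trans[rotated])
    qed
  qed
  moreover have "emeasure M E = (SUP K\<in>{K. compactin T K \<and> K \<subseteq> E}. emeasure M K)" if E: "E \<in> sets M" for E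
  proof (rule antisym)
    show "(SUP K\<in>{K. compactin T K \<and> K \<subseteq> E}. emeasure M K) \<le> emeasure M E"
      using E by (auto intro!: SUP_least emeasure_mono)
    show "emeasure M E \<le> (SUP K\<in>{K. compactin T K \<and> K \<subseteq> E}. emeasure M K)"
    proof (rule ennreal_le_epsilon)
      fix e :: real assume "0 < e"
      then obtain K where K: "compactin T K" "K \<subseteq> E" "emeasure M E \<le> emeasure M K + ennreal e"
        using radon_subprob_inner_approx[OF T M E[unfolded sets]] by blast
      have "emeasure M K \<le> (SUP K\<in>{K. compactin T K \<and> K \<subseteq> E}. emeasure M K)"
        using K by (intro SUP_upper) auto
      then have "emeasure M K + ennreal e \<le> (SUP K\<in>{K. compactin T K \<and> K \<subseteq> E}. emeasure M K) + ennreal e"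
        by (rule add_right_mono)
      with K(3) show "emeasure M E \<le> (SUP K\<in>{K. compactin T K \<and> K \<subseteq> E}. emeasure M K) + ennreal e"
        by (rule order_trans)
    qed
  qed
  ultimately show ?L
    unfolding regular_borel_prob_def using sets by blast
qed

section \<open>Integrals through level sets\<close>

text \<open>
  There are at least \<open>\<lceil>r n\<rceil> - 1\<close> indices \<open>i\<close> with \<open>i/n < r\<close> and at most \<open>\<lfloor>r n\<rfloor>\<close> with
  \<open>i/n \<le> r\<close>, so any set of indices in between determines \<open>r\<close> up to \<open>1/n\<close>.
\<close>

lemma level_set_count:
  fixes r :: real and n :: nat
  assumes n: "0 < n" and r: "0 \<le> r" "r \<le> 1"
    and I: "{i\<in>{1..n}. real i / real n < r} \<subseteq> I" "I \<subseteq> {i\<in>{1..n}. real i / real n \<le> r}"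
  shows "real (card I) \<le> r * real n" "r * real n - 1 \<le> real (card I)"
proof -
  have fin: "finite I" using I(2) finite_subset by fastforce
  have "I \<subseteq> {1..nat \<lfloor>r * real n\<rfloor>}"
    using I(2) n by (auto simp: field_simps le_nat_floor)
  then have "card I \<le> nat \<lfloor>r * real n\<rfloor>"
    using card_mono[of "{1..nat \<lfloor>r * real n\<rfloor>}" I] by simp
  then show "real (card I) \<le> r * real n"
    using r by (meson mult_nonneg_nonneg of_nat_0_le_iff of_nat_floor of_nat_le_iff order_trans)
  have "{1..<nat \<lceil>r * real n\<rceil>} \<subseteq> {i\<in>{1..n}. real i / real n < r}"
  proof
    fix i assume i: "i \<in> {1..<nat \<lceil>r * real n\<rceil>}"
    then have "real i < r * real n" by (simp add: less_ceiling_iff zless_nat_eq_int_zless)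
    moreover have "r * real n \<le> real n" using r by (simp add: mult_left_le_one_le)
    ultimately have "real i < r * real n" "i \<le> n" by linarith+
    then show "i \<in> {i\<in>{1..n}. real i / real n < r}"
      using i n by (auto simp: divide_less_eq)
  qed
  then have "card {1..<nat \<lceil>r * real n\<rceil>} \<le> card I"
    using I(1) fin by (intro card_mono) auto
  then have "nat \<lceil>r * real n\<rceil> - 1 \<le> card I" by simp
  moreover have "r * real n \<le> real (nat \<lceil>r * real n\<rceil>)" by (rule real_nat_ceiling_ge)
  ultimately show "r * real n - 1 \<le> real (card I)" by linarith
qed

text \<open>
  A discrete layer cake formula. The sets \<open>A i\<close> may be chosen freely between the open and the
  closed superlevel sets of \<open>f\<close>, so that one may take open sets for a lower semicontinuous and
  closed sets for an upper semicontinuous \<open>f\<close>. It turns inequalities between the measures of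
  such sets into inequalities between integrals.
\<close>

lemma level_set_sum_bounds:
  fixes f :: "'a \<Rightarrow> ennreal" and n :: nat
  assumes f[measurable]: "f \<in> borel_measurable M" and f1: "\<And>x. x \<in> space M \<Longrightarrow> f x \<le> 1"
    and n: "0 < n" and A: "\<And>i. i \<in> {1..n} \<Longrightarrow> A i \<in> sets M"
    and lower: "\<And>i. i \<in> {1..n} \<Longrightarrow> {x\<in>space M. ennreal (real i / real n) < f x} \<subseteq> A i"
    and upper: "\<And>i. i \<in> {1..n} \<Longrightarrow> A i \<subseteq> {x\<in>space M. ennreal (real i / real n) \<le> f x}"
  shows "(\<Sum>i=1..n. emeasure M (A i)) * ennreal (1 / real n) \<le> (\<integral>\<^sup>+x. f x \<partial>M)"
    and "(\<integral>\<^sup>+x. f x \<partial>M) \<le>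
      (\<Sum>i=1..n. emeasure M (A i)) * ennreal (1 / real n) + emeasure M (space M) * ennreal (1 / real n)"
proof -
  have *: "(\<Sum>i=1..n. indicator (A i) x) * ennreal (1 / real n) \<le> f x \<and>
      f x \<le> (\<Sum>i=1..n. indicator (A i) x) * ennreal (1 / real n) + ennreal (1 / real n)"
    if x: "x \<in> space M" for x
  proof -
    obtain r where r: "f x = ennreal r" "0 \<le> r" "r \<le> 1"
      using f1[OF x] by (cases "f x") (auto simp: top_unique)
    define I where "I = {i\<in>{1..n}. x \<in> A i}"
    have "(\<Sum>i=1..n. indicator (A i) x :: ennreal) = (\<Sum>i\<in>I. 1)"
      unfolding I_def by (rule sum.mono_neutral_cong_right) auto
    also have "\<dots> = ennreal (real (card I))" by (simp add: ennreal_of_nat_eq_real_of_nat)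
    finally have sum: "(\<Sum>i=1..n. indicator (A i) x) * ennreal (1 / real n) = ennreal (real (card I) / real n)"
      by (simp flip: ennreal_mult)
    have I1: "{i\<in>{1..n}. real i / real n < r} \<subseteq> I"
      using lower x r by (force simp: I_def ennreal_less_iff)
    have I2: "I \<subseteq> {i\<in>{1..n}. real i / real n \<le> r}"
      using upper x r by (force simp: I_def)
    show ?thesis
      unfolding sum r(1) using level_set_count[OF n r(2,3) I1 I2] n r
      by (auto simp: field_simps simp flip: ennreal_plus)
  qed
  have eq: "(\<integral>\<^sup>+x. (\<Sum>i=1..n. indicator (A i) x) * ennreal (1 / real n) \<partial>M) =
      (\<Sum>i=1..n. emeasure M (A i)) * ennreal (1 / real n)"
    using A by (subst nn_integral_multc; (subst nn_integral_sum)?) auto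
  have "(\<integral>\<^sup>+x. (\<Sum>i=1..n. indicator (A i) x) * ennreal (1 / real n) \<partial>M) \<le> (\<integral>\<^sup>+x. f x \<partial>M)"
    by (rule nn_integral_mono) (use * in blast)
  then show "(\<Sum>i=1..n. emeasure M (A i)) * ennreal (1 / real n) \<le> (\<integral>\<^sup>+x. f x \<partial>M)"
    by (simp only: eq)
  have "(\<integral>\<^sup>+x. f x \<partial>M) \<le>
      (\<integral>\<^sup>+x. (\<Sum>i=1..n. indicator (A i) x) * ennreal (1 / real n) + ennreal (1 / real n) \<partial>M)"
    by (rule nn_integral_mono) (use * in blast)
  also have "\<dots> = (\<integral>\<^sup>+x. (\<Sum>i=1..n. indicator (A i) x) * ennreal (1 / real n) \<partial>M) + (\<integral>\<^sup>+x. ennreal (1 / real n) \<partial>M)"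
    using A by (intro nn_integral_add) auto
  finally show "(\<integral>\<^sup>+x. f x \<partial>M) \<le>
      (\<Sum>i=1..n. emeasure M (A i)) * ennreal (1 / real n) + emeasure M (space M) * ennreal (1 / real n)"
    by (simp only: eq) (simp add: mult.commute)
qed

section \<open>Convolution\<close>

context locally_compact_group
begin

abbreviation conv :: "'a measure \<Rightarrow> 'a measure \<Rightarrow> 'a measure" where
  "conv \<equiv> group_convolution G T"

abbreviation translate_preimage :: "'a set \<Rightarrow> 'a \<Rightarrow> 'a set" where
  "translate_preimage E x \<equiv> {y \<in> carrier G. y \<otimes> x \<in> E}"

definition right_translate :: "'a measure \<Rightarrow> 'a \<Rightarrow> 'a measure" where
  "right_translate \<alpha> x = distr \<alpha> (borel_of T) (\<lambda>y. y \<otimes> x)"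

lemma r_coset_inv_eq:
  assumes "E \<subseteq> carrier G" "x \<in> carrier G"
  shows "E #> inv x = translate_preimage E x"
proof -
  have "y \<in> E #> inv x" if "y \<in> carrier G" "y \<otimes> x \<in> E" for y
    using that assms by (auto simp: r_coset_def m_assoc intro!: bexI[of _ "y \<otimes> x"])
  then show ?thesis using assms by (auto simp: r_coset_def m_assoc subset_iff)
qed

lemma continuous_map_right_mult:
  assumes "x \<in> carrier G" shows "continuous_map T T (\<lambda>y. y \<otimes> x)"
proof -
  have "continuous_map T (prod_topology T T) (\<lambda>y. (y, x))"
    using assms by (simp add: continuous_map_pairwise o_def topspace_eq)
  from continuous_map_compose[OF this continuous_mult] show ?thesis
    by (simp add: o_def)
qed

lemma right_mult_measurable:
  "x \<in> carrier G \<Longrightarrow> (\<lambda>y. y \<otimes> x) \<in> borel_of T \<rightarrow>\<^sub>M borel_of T"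
  by (intro continuous_map_measurable_borel_of continuous_map_right_mult)

lemma open_translate_preimage:
  assumes "openin T U" "x \<in> carrier G" shows "openin T (translate_preimage U x)"
  using openin_continuous_map_preimage[OF continuous_map_right_mult assms(1)] assms(2)
  by (simp add: topspace_eq)

lemma translate_preimage_sets:
  assumes "E \<in> sets (borel_of T)" "x \<in> carrier G"
  shows "translate_preimage E x \<in> sets (borel_of T)"
  using measurable_sets[OF right_mult_measurable[OF assms(2)] assms(1)]
  by (simp add: vimage_def Int_def conj_commute topspace_eq)

lemma emeasure_right_translate:
  assumes "sets \<alpha> = sets (borel_of T)" "x \<in> carrier G" "E \<in> sets (borel_of T)"
  shows "emeasure (right_translate \<alpha> x) E = emeasure \<alpha> (translate_preimage E x)"
proof -
  have "(\<lambda>y. y \<otimes> x) \<in> \<alpha> \<rightarrow>\<^sub>M borel_of T"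
    using right_mult_measurable[OF assms(2)] measurable_cong_sets[OF assms(1) refl] by blast
  moreover have "space \<alpha> = carrier G"
    using sets_eq_imp_space_eq[OF assms(1)] by (simp add: topspace_eq)
  ultimately show ?thesis
    using assms by (simp add: right_translate_def emeasure_distr vimage_def Int_def conj_commute)
qed

lemma tube_mult:
  assumes K: "compactin T K" and x: "x \<in> carrier G" and U: "openin T U"
    and KU: "K \<subseteq> translate_preimage U x"
  obtains V where "openin T V" "x \<in> V" "\<And>z. z \<in> V \<Longrightarrow> K \<subseteq> translate_preimage U z"
proof -
  define W where "W = {p \<in> topspace (prod_topology T T). (case p of (y, z) \<Rightarrow> y \<otimes> z) \<in> U}"
  have W: "openin (prod_topology T T) W"
    unfolding W_def by (rule openin_continuous_map_preimage[OF continuous_mult U])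
  have sub: "K \<times> {x} \<subseteq> W" using KU x by (auto simp: W_def topspace_eq)
  have cx: "compactin T {x}" using x by (simp add: topspace_eq)
  obtain U' V where UV: "openin T U'" "openin T V" "K \<subseteq> U'" "{x} \<subseteq> V" "U' \<times> V \<subseteq> W"
    using Wallace_theorem_prod_topology[OF K cx W sub] .
  have "K \<subseteq> translate_preimage U z" if "z \<in> V" for z
  proof
    fix y assume "y \<in> K"
    then have "(y, z) \<in> W" using that UV(3,5) by blast
    then show "y \<in> translate_preimage U z" by (simp add: W_def topspace_eq)
  qed
  then show ?thesis using that UV by blast
qed

text \<open>
  Lower semicontinuity of \<open>x \<mapsto> \<alpha>(Ux\<^sup>-\<^sup>1)\<close>: a compact subset of \<open>Ux\<^sup>-\<^sup>1\<close> of measure above \<open>t\<close>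
  is also contained in \<open>Uz\<^sup>-\<^sup>1\<close> for all \<open>z\<close> near \<open>x\<close>.
\<close>

lemma open_superlevel_translate:
  assumes \<alpha>: "radon_subprob T \<alpha>" and U: "openin T U"
  shows "openin T {x \<in> carrier G. t < emeasure \<alpha> (translate_preimage U x)}"
proof (subst openin_subopen, safe)
  fix x assume x: "x \<in> carrier G" and t: "t < emeasure \<alpha> (translate_preimage U x)"
  have "emeasure \<alpha> (translate_preimage U x) =
      (SUP K\<in>{K. compactin T K \<and> K \<subseteq> translate_preimage U x}. emeasure \<alpha> K)"
    using \<alpha> open_translate_preimage[OF U x] by (simp add: radon_subprob_def)
  with t obtain K where K: "compactin T K" "K \<subseteq> translate_preimage U x" "t < emeasure \<alpha> K"
    by (auto simp: less_SUP_iff)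
  obtain V where V: "openin T V" "x \<in> V" "\<And>z. z \<in> V \<Longrightarrow> K \<subseteq> translate_preimage U z"
    using tube_mult[OF K(1) x U K(2)] by blast
  have "V \<subseteq> {x \<in> carrier G. t < emeasure \<alpha> (translate_preimage U x)}"
  proof
    fix z assume z: "z \<in> V"
    then have zc: "z \<in> carrier G" using openin_subset[OF V(1)] by (auto simp: topspace_eq)
    note K(3)
    also have "emeasure \<alpha> K \<le> emeasure \<alpha> (translate_preimage U z)"
      using V(3)[OF z] translate_preimage_sets[OF openin_sets_borel_of[OF U] zc]
      by (intro emeasure_mono) (auto simp: radon_subprob_sets[OF \<alpha>])
    finally show "z \<in> {x \<in> carrier G. t < emeasure \<alpha> (translate_preimage U x)}" using zc by simp
  qed
  then show "\<exists>V. openin T V \<and> x \<in> V \<and> V \<subseteq> {x \<in> carrier G. t < emeasure \<alpha> (translate_preimage U x)}"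
    using V by blast
qed

text \<open>
  Measurability is a matter of the open sets alone, since they form an intersection-stable
  generator. This replaces joint measurability of the multiplication, which may fail for the
  product of the Borel \<open>\<sigma>\<close>-algebras.
\<close>

lemma right_translate_kernel:
  assumes \<alpha>: "radon_subprob T \<alpha>"
  shows "right_translate \<alpha> \<in> borel_of T \<rightarrow>\<^sub>M subprob_algebra (borel_of T)"
proof (rule measurable_subprob_algebra_generated[OF sets_borel_of])
  note sets = radon_subprob_sets[OF \<alpha>]
  show "Int_stable {U. openin T U}" by (auto simp: Int_stable_def)
  show "{U. openin T U} \<subseteq> Pow (topspace T)" by (auto dest: openin_subset)
  fix x assume "x \<in> space (borel_of T)"
  then have x: "x \<in> carrier G" by (simp add: topspace_eq)
  show "sets (right_translate \<alpha> x) = sets (borel_of T)" by (simp add: right_translate_def)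
  show "subprob_space (right_translate \<alpha> x)"
  proof (rule subprob_spaceI)
    have sp: "space (right_translate \<alpha> x) = topspace T" by (simp add: right_translate_def)
    show "emeasure (right_translate \<alpha> x) (space (right_translate \<alpha> x)) \<le> 1"
      unfolding sp using emeasure_right_translate[OF sets x openin_sets_borel_of[OF openin_topspace]]
      by (simp add: radon_subprob_le_1[OF \<alpha>])
    show "space (right_translate \<alpha> x) \<noteq> {}" unfolding sp using x by (auto simp: topspace_eq)
  qed
next
  note sets = radon_subprob_sets[OF \<alpha>]
  have meas: "(\<lambda>x. emeasure (right_translate \<alpha> x) U) \<in> borel_measurable (borel_of T)" if U: "openin T U" for U
  proof (rule borel_measurableI_greater)
    fix t
    have "{x \<in> space (borel_of T). t < emeasure (right_translate \<alpha> x) U} =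
        {x \<in> carrier G. t < emeasure \<alpha> (translate_preimage U x)}"
      using emeasure_right_translate[OF sets _ openin_sets_borel_of[OF U]] by (auto simp: topspace_eq)
    then show "{x \<in> space (borel_of T). t < emeasure (right_translate \<alpha> x) U} \<in> sets (borel_of T)"
      using open_superlevel_translate[OF \<alpha> U] by (simp add: openin_sets_borel_of)
  qed
  then show "(\<lambda>x. emeasure (right_translate \<alpha> x) U) \<in> borel_measurable (borel_of T)" if "U \<in> {U. openin T U}" for U
    using that by simp
  show "(\<lambda>x. emeasure (right_translate \<alpha> x) (topspace T)) \<in> borel_measurable (borel_of T)"
    by (rule meas) simp
qed

lemma measurable_emeasure_translate:
  assumes \<alpha>: "radon_subprob T \<alpha>" and E: "E \<in> sets (borel_of T)"
  shows "(\<lambda>x. emeasure \<alpha> (translate_preimage E x)) \<in> borel_measurable (borel_of T)"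
proof -
  have "(\<lambda>x. emeasure (right_translate \<alpha> x) E) \<in> borel_measurable (borel_of T)"
    using measurable_emeasure_kernel[OF right_translate_kernel[OF \<alpha>] E] .
  then show ?thesis
    using emeasure_right_translate[OF radon_subprob_sets[OF \<alpha>] _ E]
    by (subst measurable_cong[where g = "\<lambda>x. emeasure (right_translate \<alpha> x) E"]) (auto simp: topspace_eq)
qed

text \<open>
  A set function that is not countably additive makes \<open>measure_of\<close> return the null measure.
  The bind of the translation kernel takes the same values on Borel sets and is a measure by
  construction.
\<close>

lemma conv_eq_bind:
  assumes \<alpha>: "radon_subprob T \<alpha>" and \<beta>: "sets \<beta> = sets (borel_of T)"
  shows "conv \<alpha> \<beta> = \<beta> \<bind> right_translate \<alpha>"
proof -
  have space: "space \<beta> = carrier G" using sets_eq_imp_space_eq[OF \<beta>] by (simp add: topspace_eq)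
  have k: "right_translate \<alpha> \<in> \<beta> \<rightarrow>\<^sub>M subprob_algebra (borel_of T)"
    using right_translate_kernel[OF \<alpha>] measurable_cong_sets[OF \<beta> refl] by blast
  have ne: "space \<beta> \<noteq> {}" unfolding space using one_closed by blast
  have sets: "sets (\<beta> \<bind> right_translate \<alpha>) = sets (borel_of T)"
    by (rule sets_bind_measurable[OF k ne])
  have "conv \<alpha> \<beta> = measure_of (topspace T) (sets (borel_of T)) (emeasure (\<beta> \<bind> right_translate \<alpha>))"
    unfolding group_convolution_def
  proof (rule measure_of_eq)
    show "sets (borel_of T) \<subseteq> Pow (topspace T)" using sets.space_closed[of "borel_of T"] by simp
    fix E assume "E \<in> sigma_sets (topspace T) (sets (borel_of T))"
    then have E: "E \<in> sets (borel_of T)" using sets.sigma_sets_eq[of "borel_of T"] by simp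
    then have Esub: "E \<subseteq> carrier G" using sets.sets_into_space[OF E] by (simp add: topspace_eq)
    have "(\<integral>\<^sup>+ x. emeasure \<alpha> (E #> inv x) \<partial>\<beta>) = (\<integral>\<^sup>+ x. emeasure (right_translate \<alpha> x) E \<partial>\<beta>)"
      using emeasure_right_translate[OF radon_subprob_sets[OF \<alpha>] _ E] Esub
      by (intro nn_integral_cong) (simp add: space r_coset_inv_eq)
    then show "(\<integral>\<^sup>+ x. emeasure \<alpha> (E #> inv x) \<partial>\<beta>) = emeasure (\<beta> \<bind> right_translate \<alpha>) E"
      by (simp add: emeasure_bind[OF ne k E])
  qed
  also have "\<dots> = \<beta> \<bind> right_translate \<alpha>"
    using measure_of_of_measure[of "\<beta> \<bind> right_translate \<alpha>"] sets_eq_imp_space_eq[OF sets]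
    by (simp add: sets)
  finally show ?thesis .
qed

lemma sets_conv [simp]: "sets (conv \<alpha> \<beta>) = sets (borel_of T)"
  using sets.sigma_sets_eq[of "borel_of T"] sets.space_closed[of "borel_of T"]
  by (simp add: group_convolution_def)

lemma emeasure_conv:
  assumes \<alpha>: "radon_subprob T \<alpha>" and \<beta>: "sets \<beta> = sets (borel_of T)" and E: "E \<in> sets (borel_of T)"
  shows "emeasure (conv \<alpha> \<beta>) E = (\<integral>\<^sup>+ x. emeasure \<alpha> (translate_preimage E x) \<partial>\<beta>)"
proof -
  have space: "space \<beta> = carrier G" using sets_eq_imp_space_eq[OF \<beta>] by (simp add: topspace_eq)
  have k: "right_translate \<alpha> \<in> \<beta> \<rightarrow>\<^sub>M subprob_algebra (borel_of T)"
    using right_translate_kernel[OF \<alpha>] measurable_cong_sets[OF \<beta> refl] by blast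
  have ne: "space \<beta> \<noteq> {}" unfolding space using one_closed by blast
  have "emeasure (conv \<alpha> \<beta>) E = (\<integral>\<^sup>+ x. emeasure (right_translate \<alpha> x) E \<partial>\<beta>)"
    by (simp add: conv_eq_bind[OF \<alpha> \<beta>] emeasure_bind[OF ne k E])
  also have "\<dots> = (\<integral>\<^sup>+ x. emeasure \<alpha> (translate_preimage E x) \<partial>\<beta>)"
    using emeasure_right_translate[OF radon_subprob_sets[OF \<alpha>] _ E]
    by (intro nn_integral_cong) (simp add: space)
  finally show ?thesis .
qed

lemma emeasure_conv_carrier:
  assumes \<alpha>: "radon_subprob T \<alpha>" and \<beta>: "sets \<beta> = sets (borel_of T)"
  shows "emeasure (conv \<alpha> \<beta>) (carrier G) = emeasure \<alpha> (carrier G) * emeasure \<beta> (carrier G)"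
proof -
  have space: "space \<beta> = carrier G" using sets_eq_imp_space_eq[OF \<beta>] by (simp add: topspace_eq)
  have "carrier G \<in> sets (borel_of T)" using openin_sets_borel_of[OF openin_topspace, of T] by (simp add: topspace_eq)
  then have "emeasure (conv \<alpha> \<beta>) (carrier G) =
      (\<integral>\<^sup>+ x. emeasure \<alpha> (translate_preimage (carrier G) x) \<partial>\<beta>)"
    by (rule emeasure_conv[OF \<alpha> \<beta>])
  also have "\<dots> = (\<integral>\<^sup>+ x. emeasure \<alpha> (carrier G) \<partial>\<beta>)"
    by (rule nn_integral_cong, rule arg_cong[where f = "emeasure \<alpha>"]) (auto simp: space)
  finally show ?thesis by (simp add: space)
qed

lemma compact_mult_image:
  assumes "compactin T K" "compactin T L"
  shows "compactin T ((\<lambda>(x, y). x \<otimes> y) ` (K \<times> L))"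
  using assms by (intro image_compactin[OF _ continuous_mult]) (simp add: compactin_Times)

text \<open>
  Finitely many products of a compact subset of some \<open>Ux\<^sup>-\<^sup>1\<close> with a compact neighbourhood of
  \<open>x\<close> suffice to see the large values of \<open>\<alpha>(Ux\<^sup>-\<^sup>1)\<close>, uniformly for \<open>x\<close> in a compact set. This
  is the step that yields the regularity of convolutions.
\<close>

lemma compact_superlevel_translate:
  assumes \<alpha>: "radon_subprob T \<alpha>" and U: "openin T U" and L: "compactin T L"
    and t: "\<And>x. x \<in> L \<Longrightarrow> t < emeasure \<alpha> (translate_preimage U x)"
  shows "\<exists>C. compactin T C \<and> C \<subseteq> U \<and> (\<forall>x\<in>L. t \<le> emeasure \<alpha> (translate_preimage C x))"
proof -
  have Lc: "L \<subseteq> carrier G" using compactin_subset_topspace[OF L] by (simp add: topspace_eq)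
  have nb: "neighbourhood_base_of (compactin T) T"
    using locally_compact Hausdorff locally_compact_space_neighbourhood_base by blast
  define good where "good C x \<longleftrightarrow> t \<le> emeasure \<alpha> (translate_preimage C x)" for C x
  have good_mono: "good C' x" if "good C x" "C \<subseteq> C'" "compactin T C'" "x \<in> carrier G" for C C' x
  proof -
    have "emeasure \<alpha> (translate_preimage C x) \<le> emeasure \<alpha> (translate_preimage C' x)"
      using translate_preimage_sets[OF compactin_sets_borel_of[OF Hausdorff that(3)] that(4)] that(2)
      by (intro emeasure_mono) (auto simp: radon_subprob_sets[OF \<alpha>])
    with that(1) show ?thesis unfolding good_def by (rule order_trans)
  qed
  define \<V> where "\<V> = {V. openin T V \<and> (\<exists>C. compactin T C \<and> C \<subseteq> U \<and> (\<forall>x\<in>V. good C x))}"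
  have cover: "\<exists>V\<in>\<V>. x \<in> V" if x: "x \<in> L" for x
  proof -
    have xc: "x \<in> carrier G" using x Lc by blast
    have "emeasure \<alpha> (translate_preimage U x) =
        (SUP K\<in>{K. compactin T K \<and> K \<subseteq> translate_preimage U x}. emeasure \<alpha> K)"
      using \<alpha> open_translate_preimage[OF U xc] by (simp add: radon_subprob_def)
    with t[OF x] obtain K where K: "compactin T K" "K \<subseteq> translate_preimage U x" "t < emeasure \<alpha> K"
      by (auto simp: less_SUP_iff)
    obtain V where V: "openin T V" "x \<in> V" "\<And>z. z \<in> V \<Longrightarrow> K \<subseteq> translate_preimage U z"
      using tube_mult[OF K(1) xc U K(2)] by blast
    obtain W D where WD: "openin T W" "compactin T D" "x \<in> W" "W \<subseteq> D" "D \<subseteq> V"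
      using nb[unfolded neighbourhood_base_of, THEN spec, THEN spec, THEN mp, OF conjI, OF V(1,2)]
      by (elim exE conjE)
    define C where "C = (\<lambda>(x, y). x \<otimes> y) ` (K \<times> D)"
    have C: "compactin T C" unfolding C_def by (rule compact_mult_image[OF K(1) WD(2)])
    moreover have "C \<subseteq> U" using V(3) WD(5) by (auto simp: C_def)
    moreover have "good C z" if z: "z \<in> W" for z
    proof -
      have zc: "z \<in> carrier G" using z openin_subset[OF WD(1)] by (auto simp: topspace_eq)
      have "K \<subseteq> translate_preimage C z"
        using compactin_subset_topspace[OF K(1)] z WD(4) unfolding C_def by (auto simp: topspace_eq)
      then have "emeasure \<alpha> K \<le> emeasure \<alpha> (translate_preimage C z)"
        using translate_preimage_sets[OF compactin_sets_borel_of[OF Hausdorff C] zc]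
        by (intro emeasure_mono) (auto simp: radon_subprob_sets[OF \<alpha>])
      with K(3) show ?thesis unfolding good_def by (meson less_imp_le order_trans)
    qed
    ultimately have "W \<in> \<V>" using WD(1) unfolding \<V>_def by blast
    then show ?thesis using WD(3) by blast
  qed
  have "openin T V" if "V \<in> \<V>" for V using that by (simp add: \<V>_def)
  moreover have "L \<subseteq> \<Union>\<V>" using cover by blast
  ultimately have "\<exists>F. finite F \<and> F \<subseteq> \<V> \<and> L \<subseteq> \<Union>F" by (rule compactinD[OF L])
  then obtain F where F: "finite F" "F \<subseteq> \<V>" "L \<subseteq> \<Union>F" by blast
  have "\<forall>V\<in>F. \<exists>C. compactin T C \<and> C \<subseteq> U \<and> (\<forall>x\<in>V. good C x)"
    using F(2) unfolding \<V>_def by blast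
  from bchoice[OF this] obtain C where C: "\<forall>V\<in>F. compactin T (C V) \<and> C V \<subseteq> U \<and> (\<forall>x\<in>V. good (C V) x)" ..
  have CF: "compactin T (\<Union>V\<in>F. C V)"
    using F(1) C by (intro compactin_Union) auto
  moreover have "(\<Union>V\<in>F. C V) \<subseteq> U" using C by blast
  moreover have "good (\<Union>V\<in>F. C V) x" if x: "x \<in> L" for x
  proof -
    obtain V where V: "V \<in> F" "x \<in> V" using x F(3) by blast
    show ?thesis using good_mono[of "C V" x, OF _ _ CF] C V Lc x by blast
  qed
  ultimately show ?thesis unfolding good_def by blast
qed

text \<open>
  The mass \<open>\<integral> \<alpha>(Ux\<^sup>-\<^sup>1) d\<beta>(x)\<close> of an open set is, up to \<open>1/n\<close>, the mean of the \<open>\<beta>\<close>-measures of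
  \<open>n\<close> open superlevel sets. Each of these is replaced by a compact subset, over which a
  compact part of \<open>U\<close> already produces the required values.
\<close>

lemma radon_subprob_conv:
  assumes \<alpha>: "radon_subprob T \<alpha>" and \<beta>: "radon_subprob T \<beta>"
  shows "radon_subprob T (conv \<alpha> \<beta>)"
proof (rule radon_subprobI)
  note sets\<beta> = radon_subprob_sets[OF \<beta>]
  have space: "space \<beta> = carrier G" using radon_subprob_space[OF \<beta>] by (simp add: topspace_eq)
  show "sets (conv \<alpha> \<beta>) = sets (borel_of T)" by simp
  show "emeasure (conv \<alpha> \<beta>) (topspace T) \<le> 1"
    unfolding topspace_eq emeasure_conv_carrier[OF \<alpha> sets\<beta>]
    using mult_mono[OF radon_subprob_le_1[OF \<alpha>] radon_subprob_le_1[OF \<beta>]] by simp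
  fix U and e :: real assume U: "openin T U" and e: "0 < e"
  let ?f = "\<lambda>E x. emeasure \<alpha> (translate_preimage E x)"
  have meas: "?f E \<in> borel_measurable \<beta>" if "E \<in> sets (borel_of T)" for E
    using measurable_emeasure_translate[OF \<alpha> that] measurable_cong_sets[OF sets\<beta> refl] by blast
  obtain n :: nat where n: "0 < n" "1 / real n < e / 2"
    using e by (metis half_gt_zero nat_approx_posE zero_less_Suc)
  define A where "A i = {x \<in> carrier G. ennreal (real i / real n) < ?f U x}" for i :: nat
  have A: "openin T (A i)" for i
    unfolding A_def by (rule open_superlevel_translate[OF \<alpha> U])
  have "\<exists>L. compactin T L \<and> L \<subseteq> A i \<and> emeasure \<beta> (A i) \<le> emeasure \<beta> L + ennreal (e / 2)" for i
    using radon_subprob_open_approx[OF \<beta> A, of "e / 2" i] e by (metis half_gt_zero)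
  then obtain L where L: "\<And>i. compactin T (L i)" "\<And>i. L i \<subseteq> A i"
    "\<And>i. emeasure \<beta> (A i) \<le> emeasure \<beta> (L i) + ennreal (e / 2)" by metis
  have "\<exists>C. compactin T C \<and> C \<subseteq> U \<and> (\<forall>x\<in>L i. ennreal (real i / real n) \<le> ?f C x)" for i
  proof -
    have *: "ennreal (real i / real n) < ?f U x" if "x \<in> L i" for x
      using subsetD[OF L(2) that] unfolding A_def by simp
    show ?thesis by (rule compact_superlevel_translate[OF \<alpha> U L(1) *])
  qed
  then obtain C where C: "\<And>i. compactin T (C i)" "\<And>i. C i \<subseteq> U"
    "\<And>i x. x \<in> L i \<Longrightarrow> ennreal (real i / real n) \<le> ?f (C i) x" by metis
  define K where "K = (\<Union>i\<in>{1..n}. C i)"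
  have K: "compactin T K" unfolding K_def using C by (intro compactin_Union) auto
  have Ksets: "K \<in> sets (borel_of T)" using K by (simp add: compactin_sets_borel_of Hausdorff)
  have fK: "?f (C i) x \<le> ?f K x" if "i \<in> {1..n}" "x \<in> carrier G" for i x
    using that translate_preimage_sets[OF Ksets that(2)]
    by (intro emeasure_mono) (auto simp: radon_subprob_sets[OF \<alpha>] K_def)
  define B where "B i = {x \<in> space \<beta>. ennreal (real i / real n) \<le> ?f K x}" for i :: nat
  have B: "B i \<in> sets \<beta>" for i
    unfolding B_def using meas[OF Ksets] by measurable
  have LB: "emeasure \<beta> (L i) \<le> emeasure \<beta> (B i)" if i: "i \<in> {1..n}" for i
  proof (rule emeasure_mono[OF _ B])
    show "L i \<subseteq> B i"
    proof
      fix x assume x: "x \<in> L i"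
      then have xc: "x \<in> carrier G"
        using compactin_subset_topspace[OF L(1)] by (auto simp: topspace_eq)
      with order_trans[OF C(3)[OF x] fK[OF i xc]] show "x \<in> B i"
        by (simp add: B_def space)
    qed
  qed
  have "emeasure (conv \<alpha> \<beta>) U = (\<integral>\<^sup>+x. ?f U x \<partial>\<beta>)"
    by (rule emeasure_conv[OF \<alpha> sets\<beta> openin_sets_borel_of[OF U]])
  also have "\<dots> \<le> (\<Sum>i=1..n. emeasure \<beta> (A i)) * ennreal (1 / real n) + emeasure \<beta> (space \<beta>) * ennreal (1 / real n)"
    using A by (intro level_set_sum_bounds(2) meas openin_sets_borel_of[OF U] n)
      (auto simp: radon_subprob_le_1[OF \<alpha>] A_def space sets\<beta> intro: openin_sets_borel_of)
  also have "\<dots> \<le> (\<Sum>i=1..n. emeasure \<beta> (B i) + ennreal (e / 2)) * ennreal (1 / real n) + 1 * ennreal (1 / real n)"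
  proof (intro add_mono mult_right_mono sum_mono radon_subprob_le_1[OF \<beta>])
    show "emeasure \<beta> (A i) \<le> emeasure \<beta> (B i) + ennreal (e / 2)" if "i \<in> {1..n}" for i
      using L(3) add_right_mono[OF LB[OF that]] by (rule order_trans)
  qed auto
  also have "\<dots> = (\<Sum>i=1..n. emeasure \<beta> (B i)) * ennreal (1 / real n) + (ennreal (e / 2) + ennreal (1 / real n))"
  proof -
    have "of_nat n * ennreal (e / 2) * ennreal (1 / real n) = ennreal (e / 2)"
      using n e by (simp add: ennreal_of_nat_eq_real_of_nat flip: ennreal_mult)
    then show ?thesis by (simp add: sum.distrib distrib_right add.assoc)
  qed
  also have "\<dots> \<le> (\<integral>\<^sup>+x. ?f K x \<partial>\<beta>) + ennreal e"
  proof (rule add_mono)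
    show "(\<Sum>i=1..n. emeasure \<beta> (B i)) * ennreal (1 / real n) \<le> (\<integral>\<^sup>+x. ?f K x \<partial>\<beta>)"
      by (intro level_set_sum_bounds(1) meas Ksets n B) (auto simp: B_def radon_subprob_le_1[OF \<alpha>])
    show "ennreal (e / 2) + ennreal (1 / real n) \<le> ennreal e"
      using n e by (simp flip: ennreal_plus)
  qed
  also have "(\<integral>\<^sup>+x. ?f K x \<partial>\<beta>) = emeasure (conv \<alpha> \<beta>) K"
    by (rule emeasure_conv[OF \<alpha> sets\<beta> Ksets, symmetric])
  finally show "\<exists>K. compactin T K \<and> K \<subseteq> U \<and> emeasure (conv \<alpha> \<beta>) U \<le> emeasure (conv \<alpha> \<beta>) K + ennreal e"
    using K C(2) unfolding K_def by blast
qed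

lemma right_translate_conv:
  assumes \<alpha>: "radon_subprob T \<alpha>" and \<beta>: "radon_subprob T \<beta>" and x: "x \<in> carrier G"
  shows "right_translate (conv \<alpha> \<beta>) x = right_translate \<beta> x \<bind> right_translate \<alpha>"
proof -
  note sets\<beta> = radon_subprob_sets[OF \<beta>]
  have space: "space \<beta> = carrier G" using radon_subprob_space[OF \<beta>] by (simp add: topspace_eq)
  have ne: "space \<beta> \<noteq> {}" unfolding space using one_closed by blast
  have k: "right_translate \<alpha> \<in> \<beta> \<rightarrow>\<^sub>M subprob_algebra (borel_of T)"
    using right_translate_kernel[OF \<alpha>] measurable_cong_sets[OF sets\<beta> refl] by blast
  have mx: "(\<lambda>y. y \<otimes> x) \<in> \<beta> \<rightarrow>\<^sub>M borel_of T"
    using right_mult_measurable[OF x] measurable_cong_sets[OF sets\<beta> refl] by blast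
  have mul: "(\<lambda>z. z \<otimes> y) \<in> \<alpha> \<rightarrow>\<^sub>M borel_of T" if "y \<in> carrier G" for y
    using right_mult_measurable[OF that] measurable_cong_sets[OF radon_subprob_sets[OF \<alpha>] refl] by blast
  have "right_translate (conv \<alpha> \<beta>) x = \<beta> \<bind> (\<lambda>y. distr (right_translate \<alpha> y) (borel_of T) (\<lambda>z. z \<otimes> x))"
    unfolding conv_eq_bind[OF \<alpha> sets\<beta>] unfolding right_translate_def[of "_ \<bind> _"]
    by (rule distr_bind[OF k ne right_mult_measurable[OF x]])
  also have "\<dots> = \<beta> \<bind> (\<lambda>y. right_translate \<alpha> (y \<otimes> x))"
  proof (rule bind_cong[OF refl])
    fix y assume "y \<in> space \<beta>"
    then have y: "y \<in> carrier G" by (simp add: space)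
    have "distr (right_translate \<alpha> y) (borel_of T) (\<lambda>z. z \<otimes> x) =
        distr \<alpha> (borel_of T) ((\<lambda>z. z \<otimes> x) \<circ> (\<lambda>z. z \<otimes> y))"
      unfolding right_translate_def by (rule distr_distr[OF right_mult_measurable[OF x] mul[OF y]])
    also have "\<dots> = right_translate \<alpha> (y \<otimes> x)"
      unfolding right_translate_def using radon_subprob_space[OF \<alpha>] x y
      by (intro distr_cong) (auto simp: topspace_eq m_assoc)
    finally show "distr (right_translate \<alpha> y) (borel_of T) (\<lambda>z. z \<otimes> x) = right_translate \<alpha> (y \<otimes> x)" .
  qed
  also have "\<dots> = right_translate \<beta> x \<bind> right_translate \<alpha>"
    unfolding right_translate_def[of \<beta>]
    by (rule bind_distr[OF mx right_translate_kernel[OF \<alpha>] ne, symmetric])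
  finally show ?thesis .
qed

text \<open>
  Translating a convolution amounts to translating its right factor, and then associativity is
  that of bind.
\<close>

lemma conv_assoc:
  assumes \<alpha>: "radon_subprob T \<alpha>" and \<beta>: "radon_subprob T \<beta>" and \<gamma>: "radon_subprob T \<gamma>"
  shows "conv (conv \<alpha> \<beta>) \<gamma> = conv \<alpha> (conv \<beta> \<gamma>)"
proof -
  note sets\<gamma> = radon_subprob_sets[OF \<gamma>]
  have space: "space \<gamma> = carrier G" using radon_subprob_space[OF \<gamma>] by (simp add: topspace_eq)
  have k: "right_translate \<beta> \<in> \<gamma> \<rightarrow>\<^sub>M subprob_algebra (borel_of T)"
    using right_translate_kernel[OF \<beta>] measurable_cong_sets[OF sets\<gamma> refl] by blast
  have "conv (conv \<alpha> \<beta>) \<gamma> = \<gamma> \<bind> right_translate (conv \<alpha> \<beta>)"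
    by (rule conv_eq_bind[OF radon_subprob_conv[OF \<alpha> \<beta>] sets\<gamma>])
  also have "\<dots> = \<gamma> \<bind> (\<lambda>x. right_translate \<beta> x \<bind> right_translate \<alpha>)"
    by (rule bind_cong[OF refl]) (simp add: space right_translate_conv[OF \<alpha> \<beta>])
  also have "\<dots> = (\<gamma> \<bind> right_translate \<beta>) \<bind> right_translate \<alpha>"
    by (rule bind_assoc[OF k right_translate_kernel[OF \<alpha>], symmetric])
  also have "\<dots> = conv \<alpha> (conv \<beta> \<gamma>)"
    unfolding conv_eq_bind[OF \<alpha> sets_conv] unfolding conv_eq_bind[OF \<beta> sets\<gamma>] ..
  finally show ?thesis .
qed

end

section \<open>Measures from contents\<close>

text \<open>
  Separate the disjoint compact sets \<open>K - U\<close> and \<open>K - V\<close> by open sets and remove these from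
  \<open>K\<close>.
\<close>

lemma compactin_split:
  assumes T: "Hausdorff_space T" and K: "compactin T K"
    and U: "openin T U" and V: "openin T V" and sub: "K \<subseteq> U \<union> V"
  obtains K1 K2 where "compactin T K1" "compactin T K2" "K1 \<subseteq> U" "K2 \<subseteq> V" "K = K1 \<union> K2"
proof -
  have cU: "closedin T (topspace T - U)" and cV: "closedin T (topspace T - V)"
    using U V by auto
  have Ksub: "K \<subseteq> topspace T" by (rule compactin_subset_topspace[OF K])
  have "K - U = K \<inter> (topspace T - U)" "K - V = K \<inter> (topspace T - V)" using Ksub by auto
  then have KU: "compactin T (K - U)" and KV: "compactin T (K - V)"
    using compact_Int_closedin[OF K cU] compact_Int_closedin[OF K cV] by simp_all
  have "disjnt (K - U) (K - V)" using sub by (auto simp: disjnt_def)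
  then obtain U' V' where UV: "openin T U'" "openin T V'" "K - U \<subseteq> U'" "K - V \<subseteq> V'" "disjnt U' V'"
    using Hausdorff_space_compact_separation[OF T KU KV] by blast
  have "compactin T (K \<inter> (topspace T - U'))" "compactin T (K \<inter> (topspace T - V'))"
    using UV(1,2) by (auto intro!: compact_Int_closedin[OF K])
  moreover have "K = (K \<inter> (topspace T - U')) \<union> (K \<inter> (topspace T - V'))"
    using UV(5) Ksub by (auto simp: disjnt_def)
  ultimately show ?thesis
    using UV(3,4) by (intro that[of "K \<inter> (topspace T - U')" "K \<inter> (topspace T - V')"]) auto
qed

text \<open>
  A content in the sense of Halmos, with the normalisation that suits limits of probability
  measures. It need not agree on compact sets with the measure that it generates, which can be
  larger.
\<close>

locale compact_content =
  fixes T :: "'a topology" and c :: "'a set \<Rightarrow> ennreal"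
  assumes Hausdorff: "Hausdorff_space T"
    and content_empty: "c {} = 0"
    and content_mono: "compactin T K \<Longrightarrow> compactin T L \<Longrightarrow> K \<subseteq> L \<Longrightarrow> c K \<le> c L"
    and content_subadditive: "compactin T K \<Longrightarrow> compactin T L \<Longrightarrow> c (K \<union> L) \<le> c K + c L"
    and content_superadditive:
      "compactin T K \<Longrightarrow> compactin T L \<Longrightarrow> K \<inter> L = {} \<Longrightarrow> c K + c L \<le> c (K \<union> L)"
    and content_le_1: "compactin T K \<Longrightarrow> c K \<le> 1"
begin

definition inner_content :: "'a set \<Rightarrow> ennreal" where
  "inner_content U = (SUP K\<in>{K. compactin T K \<and> K \<subseteq> U}. c K)"

definition outer_content :: "'a set \<Rightarrow> ennreal" where
  "outer_content E = (INF U\<in>{U. openin T U \<and> E \<subseteq> U}. inner_content U)"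

lemma content_le_inner: "compactin T K \<Longrightarrow> K \<subseteq> U \<Longrightarrow> c K \<le> inner_content U"
  unfolding inner_content_def by (intro SUP_upper) auto

lemma inner_content_leI: "(\<And>K. compactin T K \<Longrightarrow> K \<subseteq> U \<Longrightarrow> c K \<le> b) \<Longrightarrow> inner_content U \<le> b"
  unfolding inner_content_def by (intro SUP_least) auto

lemma inner_content_mono: "U \<subseteq> V \<Longrightarrow> inner_content U \<le> inner_content V"
  by (intro inner_content_leI content_le_inner) auto

lemma inner_content_le_1: "inner_content U \<le> 1"
  by (intro inner_content_leI content_le_1)

lemma inner_content_empty: "inner_content {} = 0"
  using inner_content_leI[of "{}" 0] by (simp add: content_empty)

lemma outer_le_inner: "openin T U \<Longrightarrow> E \<subseteq> U \<Longrightarrow> outer_content E \<le> inner_content U"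
  unfolding outer_content_def by (intro INF_lower) auto

lemma outer_content_geI:
  "(\<And>U. openin T U \<Longrightarrow> E \<subseteq> U \<Longrightarrow> b \<le> inner_content U) \<Longrightarrow> b \<le> outer_content E"
  unfolding outer_content_def by (intro INF_greatest) auto

lemma outer_content_open: "openin T U \<Longrightarrow> outer_content U = inner_content U"
  by (intro antisym outer_le_inner outer_content_geI inner_content_mono) auto

lemma outer_content_mono: "E \<subseteq> F \<Longrightarrow> outer_content E \<le> outer_content F"
  by (intro outer_content_geI outer_le_inner) auto

lemma outer_content_approx:
  assumes "E \<subseteq> topspace T" "0 < (e::real)"
  obtains U where "openin T U" "E \<subseteq> U" "inner_content U \<le> outer_content E + ennreal e"
proof -
  have "outer_content E \<le> inner_content (topspace T)" by (intro outer_le_inner assms) simp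
  also have "\<dots> \<le> 1" by (rule inner_content_le_1)
  finally have "outer_content E \<noteq> \<top>" by (auto simp: top_unique)
  then have "outer_content E < outer_content E + ennreal e"
    using assms(2) by (cases "outer_content E") (auto simp: ennreal_less_iff simp flip: ennreal_plus)
  then obtain U where "openin T U" "E \<subseteq> U" "inner_content U < outer_content E + ennreal e"
    unfolding outer_content_def[of E] by (auto simp: INF_less_iff)
  then show ?thesis using that less_imp_le by blast
qed

text \<open>
  By \<open>compactin_split\<close> a compact set is cut along the open cover into compact pieces.
\<close>

lemma content_finite_cover:
  fixes U :: "nat \<Rightarrow> 'a set" and n :: nat
  assumes "\<And>i. openin T (U i)"
  shows "compactin T K \<Longrightarrow> K \<subseteq> (\<Union>i<n. U i) \<Longrightarrow> c K \<le> (\<Sum>i<n. inner_content (U i))"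
proof (induction n arbitrary: K)
  case 0
  then show ?case by (simp add: content_empty)
next
  case (Suc n)
  have open': "openin T (\<Union>i<n. U i)" using assms by blast
  have "K \<subseteq> (\<Union>i<n. U i) \<union> U n" using Suc.prems(2) by (auto simp: lessThan_Suc)
  from compactin_split[OF Hausdorff Suc.prems(1) open' assms this]
  obtain K1 K2 where K: "compactin T K1" "compactin T K2" "K1 \<subseteq> (\<Union>i<n. U i)" "K2 \<subseteq> U n" "K = K1 \<union> K2" .
  have "c K \<le> c K1 + c K2" unfolding K(5) by (rule content_subadditive[OF K(1,2)])
  also have "\<dots> \<le> (\<Sum>i<n. inner_content (U i)) + inner_content (U n)"
    by (intro add_mono Suc.IH content_le_inner K)
  finally show ?case by (simp add: lessThan_Suc add.commute)
qed

lemma inner_content_countably_subadditive: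
  fixes U :: "nat \<Rightarrow> 'a set"
  assumes U: "\<And>i. openin T (U i)"
  shows "inner_content (\<Union>i. U i) \<le> (\<Sum>i. inner_content (U i))"
proof (rule inner_content_leI)
  fix K assume K: "compactin T K" "K \<subseteq> (\<Union>i. U i)"
  have "\<exists>\<F>. finite \<F> \<and> \<F> \<subseteq> range U \<and> K \<subseteq> \<Union>\<F>"
    using U K(2) by (intro compactinD[OF K(1)]) auto
  then obtain I where I: "finite I" "K \<subseteq> (\<Union>i\<in>I. U i)"
    by (metis finite_subset_image)
  then obtain n where "I \<subseteq> {..<n}" using finite_nat_iff_bounded by blast
  then have "K \<subseteq> (\<Union>i<n. U i)" using I(2) by blast
  then have "c K \<le> (\<Sum>i<n. inner_content (U i))" by (rule content_finite_cover[OF U K(1)])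
  also have "\<dots> \<le> (\<Sum>i. inner_content (U i))" by (intro sum_le_suminf) auto
  finally show "c K \<le> (\<Sum>i. inner_content (U i))" .
qed

lemma outer_content_countably_subadditive:
  assumes A: "\<And>i. A i \<subseteq> topspace T"
  shows "outer_content (\<Union>i. A i) \<le> (\<Sum>i. outer_content (A i))"
proof (rule ennreal_le_epsilon)
  fix e :: real assume e: "0 < e"
  define d where "d i = e * (1/2) ^ Suc i" for i :: nat
  have d: "0 < d i" for i using e by (simp add: d_def)
  have "d sums (e * 1)" unfolding d_def by (intro sums_mult power_half_series)
  then have d_sum: "(\<Sum>i. ennreal (d i)) = ennreal e"
    using d by (intro suminf_ennreal_eq) (auto intro: less_imp_le)
  have "\<exists>U. openin T U \<and> A i \<subseteq> U \<and> inner_content U \<le> outer_content (A i) + ennreal (d i)" for i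
    using outer_content_approx[OF A d, of i i] by metis
  then obtain U where U: "\<And>i. openin T (U i)" "\<And>i. A i \<subseteq> U i"
    "\<And>i. inner_content (U i) \<le> outer_content (A i) + ennreal (d i)" by metis
  have "outer_content (\<Union>i. A i) \<le> inner_content (\<Union>i. U i)"
    using U(1,2) by (intro outer_le_inner) auto
  also have "\<dots> \<le> (\<Sum>i. inner_content (U i))"
    by (rule inner_content_countably_subadditive[OF U(1)])
  also have "\<dots> \<le> (\<Sum>i. outer_content (A i) + ennreal (d i))"
    by (rule suminf_le) (use U(3) in auto)
  also have "\<dots> = (\<Sum>i. outer_content (A i)) + ennreal e"
    by (subst suminf_add[symmetric]) (auto simp: d_sum)
  finally show "outer_content (\<Union>i. A i) \<le> (\<Sum>i. outer_content (A i)) + ennreal e" .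
qed

lemma outer_measure_space_outer_content:
  "outer_measure_space (Pow (topspace T)) outer_content"
  unfolding outer_measure_space_def
proof (intro conjI)
  show "positive (Pow (topspace T)) outer_content"
    by (simp add: positive_def outer_content_open inner_content_empty)
  show "increasing (Pow (topspace T)) outer_content"
    by (simp add: increasing_def outer_content_mono)
  show "countably_subadditive (Pow (topspace T)) outer_content"
    unfolding countably_subadditive_def by (auto intro!: outer_content_countably_subadditive)
qed

text \<open>
  A compact part of \<open>A \<inter> U\<close> leaves an open remainder of \<open>A\<close> that contains \<open>A - U\<close>, and
  disjoint compact sets have additive content. This is the nontrivial half of the Caratheodory
  criterion for \<open>U\<close>.
\<close>

lemma outer_content_open_split:
  assumes U: "openin T U" and A: "openin T A"
  shows "inner_content (A \<inter> U) + outer_content (A - U) \<le> inner_content A"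
proof -
  have "c K + outer_content (A - U) \<le> inner_content A" if K: "compactin T K" "K \<subseteq> A \<inter> U" for K
  proof -
    have "openin T (A - K)"
      using A compactin_imp_closedin[OF Hausdorff K(1)] by (rule openin_diff)
    then have "outer_content (A - U) \<le> inner_content (A - K)"
      using K by (intro outer_le_inner) auto
    then have "c K + outer_content (A - U) \<le> c K + inner_content (A - K)" by (rule add_left_mono)
    also have "\<dots> = (SUP L\<in>{L. compactin T L \<and> L \<subseteq> A - K}. c K + c L)"
      unfolding inner_content_def by (rule ennreal_SUP_add_right) (auto intro: exI[of _ "{}"])
    also have "\<dots> \<le> inner_content A"
    proof (rule SUP_least)
      fix L assume L: "L \<in> {L. compactin T L \<and> L \<subseteq> A - K}"
      then have "c K + c L \<le> c (K \<union> L)" using K by (intro content_superadditive) auto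
      also have "\<dots> \<le> inner_content A" using K L by (intro content_le_inner compactin_Un) auto
      finally show "c K + c L \<le> inner_content A" .
    qed
    finally show ?thesis .
  qed
  then have "(SUP K\<in>{K. compactin T K \<and> K \<subseteq> A \<inter> U}. c K + outer_content (A - U)) \<le> inner_content A"
    by (intro SUP_least) auto
  moreover have "(SUP K\<in>{K. compactin T K \<and> K \<subseteq> A \<inter> U}. c K + outer_content (A - U))
      = inner_content (A \<inter> U) + outer_content (A - U)"
    unfolding inner_content_def by (rule ennreal_SUP_add_left) (auto intro: exI[of _ "{}"])
  ultimately show ?thesis by simp
qed

lemma openin_lambda_system:
  assumes U: "openin T U"
  shows "U \<in> lambda_system (topspace T) (Pow (topspace T)) outer_content"
proof -
  interpret sigma_algebra "topspace T" "Pow (topspace T)" by (rule sigma_algebra_Pow)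
  have "outer_content (E \<inter> U) + outer_content (E - U) = outer_content E" if E: "E \<subseteq> topspace T" for E
  proof (rule antisym)
    show "outer_content (E \<inter> U) + outer_content (E - U) \<le> outer_content E"
    proof (rule outer_content_geI)
      fix A assume A: "openin T A" "E \<subseteq> A"
      have "outer_content (E \<inter> U) + outer_content (E - U) \<le> inner_content (A \<inter> U) + outer_content (A - U)"
        using A U by (intro add_mono outer_le_inner outer_content_mono) auto
      also have "\<dots> \<le> inner_content A" by (rule outer_content_open_split[OF U A(1)])
      finally show "outer_content (E \<inter> U) + outer_content (E - U) \<le> inner_content A" .
    qed
    have oms: "positive (Pow (topspace T)) outer_content"
      "countably_subadditive (Pow (topspace T)) outer_content"
      using outer_measure_space_outer_content by (auto simp: outer_measure_space_def)
    have "outer_content ((E \<inter> U) \<union> (E - U)) \<le> outer_content (E \<inter> U) + outer_content (E - U)"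
      by (rule subadditiveD[OF countably_subadditive_subadditive[OF oms]]) (use E in auto)
    then show "outer_content E \<le> outer_content (E \<inter> U) + outer_content (E - U)"
      by (simp add: Int_Diff_Un)
  qed
  then show ?thesis using openin_subset[OF U] by (auto simp: lambda_system_eq)
qed

text \<open>
  Open sets are Caratheodory measurable for the outer content, hence so are all Borel sets.
\<close>

theorem radon_extension:
  obtains M where "radon_subprob T M" "\<And>U. openin T U \<Longrightarrow> emeasure M U = inner_content U"
    "\<And>K. compactin T K \<Longrightarrow> c K \<le> emeasure M K"
proof -
  interpret sigma_algebra "topspace T" "Pow (topspace T)" by (rule sigma_algebra_Pow)
  define L where "L = lambda_system (topspace T) (Pow (topspace T)) outer_content"
  have ms: "measure_space (topspace T) L outer_content"
    unfolding L_def by (rule caratheodory_lemma[OF outer_measure_space_outer_content])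
  then have "sigma_algebra (topspace T) L" by (simp add: measure_space_def)
  then have sub: "sets (borel_of T) \<subseteq> L"
    unfolding sets_borel_of by (intro sigma_algebra.sigma_sets_subset) (auto simp: L_def openin_lambda_system)
  have "sigma_algebra (topspace T) (sets (borel_of T))"
    using sets.sigma_algebra_axioms[of "borel_of T"] by simp
  then have ms': "measure_space (topspace T) (sets (borel_of T)) outer_content"
    by (rule measure_down[OF ms _ sub])
  define M where "M = measure_of (topspace T) (sets (borel_of T)) outer_content"
  have sets: "sets M = sets (borel_of T)"
    unfolding M_def using sets.sigma_sets_eq[of "borel_of T"] sets.space_closed[of "borel_of T"] by simp
  have em: "emeasure M E = outer_content E" if "E \<in> sets (borel_of T)" for E
    using ms' that sets.space_closed[of "borel_of T"]
    by (intro emeasure_measure_of[OF M_def]) (auto simp: sets measure_space_def)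
  have open': "emeasure M U = inner_content U" if "openin T U" for U
    using that by (simp add: em openin_sets_borel_of outer_content_open)
  have compact: "c K \<le> emeasure M K" if K: "compactin T K" for K
    using K by (simp add: em compactin_sets_borel_of Hausdorff) (intro outer_content_geI content_le_inner)
  have "radon_subprob T M"
    unfolding radon_subprob_def
  proof (safe intro!: sets)
    show "emeasure M (topspace T) \<le> 1" by (simp add: open' inner_content_le_1)
    fix U assume U: "openin T U"
    show "emeasure M U = (SUP K\<in>{K. compactin T K \<and> K \<subseteq> U}. emeasure M K)"
    proof (rule antisym)
      show "emeasure M U \<le> (SUP K\<in>{K. compactin T K \<and> K \<subseteq> U}. emeasure M K)"
        unfolding open'[OF U] inner_content_def by (rule SUP_mono) (auto intro: compact)
      show "(SUP K\<in>{K. compactin T K \<and> K \<subseteq> U}. emeasure M K) \<le> emeasure M U"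
        using U by (auto intro!: SUP_least emeasure_mono simp: sets openin_sets_borel_of)
    qed
  qed
  then show ?thesis using that open' compact by blast
qed

end

section \<open>Limits along an ultrafilter\<close>

text \<open>
  The filter plays the role of a free ultrafilter on the natural numbers. Only convergence of
  every sequence in the compact space \<open>[0, \<infinity>]\<close> is used, and \<open>Lim F\<close> then is a total, monotone
  and additive functional on sequences.
\<close>

locale total_limit =
  fixes F :: "nat filter"
  assumes nontrivial: "F \<noteq> bot" and le_sequentially: "F \<le> sequentially"
    and total: "\<And>b :: nat \<Rightarrow> ennreal. \<exists>l. (b \<longlongrightarrow> l) F"
begin

lemma tendsto_LimI: "(b \<longlongrightarrow> Lim F b) F" for b :: "nat \<Rightarrow> ennreal"
  using total[of b] tendsto_Lim[OF nontrivial] by force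

lemma Lim_mono: "(\<forall>\<^sub>F n in sequentially. b n \<le> d n) \<Longrightarrow> Lim F b \<le> Lim F d" for b d :: "nat \<Rightarrow> ennreal"
  using tendsto_le[OF nontrivial tendsto_LimI tendsto_LimI] le_sequentially by (auto simp: le_filter_def)

lemma Lim_eq: "(\<forall>\<^sub>F n in sequentially. b n = d n) \<Longrightarrow> Lim F b = Lim F d" for b d :: "nat \<Rightarrow> ennreal"
  by (intro antisym Lim_mono) (auto elim: eventually_mono)

lemma Lim_const: "Lim F (\<lambda>n. k :: ennreal) = k"
  by (intro tendsto_Lim nontrivial tendsto_const)

lemma Lim_add: "Lim F (\<lambda>n. b n + d n) = Lim F b + Lim F d" for b d :: "nat \<Rightarrow> ennreal"
  by (intro tendsto_Lim nontrivial tendsto_add tendsto_LimI)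

lemma Lim_sum: "Lim F (\<lambda>n. \<Sum>i\<in>I. b i n) = (\<Sum>i\<in>I. Lim F (b i))" for b :: "'i \<Rightarrow> nat \<Rightarrow> ennreal"
  by (intro tendsto_Lim nontrivial tendsto_sum tendsto_LimI)

lemma Lim_mult_ennreal: "Lim F (\<lambda>n. b n * ennreal k) = Lim F b * ennreal k" for b :: "nat \<Rightarrow> ennreal"
  using ennreal_tendsto_cmult[OF ennreal_less_top tendsto_LimI[of b], of k]
  by (intro tendsto_Lim nontrivial) (simp add: mult.commute)

end

text \<open>
  By Tychonoff's theorem, the sequence of evaluation maps \<open>b \<mapsto> b(n)\<close> has a cluster point \<open>x\<close>
  in the compact space of all functions from sequences to \<open>[0, \<infinity>]\<close>. The filter of those
  indices whose evaluation map is close to \<open>x\<close> makes every sequence \<open>b\<close> converge, to \<open>x(b)\<close>.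
\<close>

lemma ex_total_limit: "\<exists>F. total_limit F"
proof -
  have "compactin (product_topology (\<lambda>i :: nat \<Rightarrow> ennreal. euclidean) UNIV)
      (PiE UNIV (\<lambda>i. UNIV :: ennreal set))"
    by (simp add: compactin_PiE compact_UNIV del: PiE_UNIV)
  then have cpt: "compact (UNIV :: ((nat \<Rightarrow> ennreal) \<Rightarrow> ennreal) set)"
    by (simp add: euclidean_product_topology)
  define ev where "ev n b = (b n :: ennreal)" for n :: nat and b
  have "filtermap ev sequentially \<noteq> bot" by (simp add: filtermap_bot_iff)
  then obtain x where x: "inf (nhds x) (filtermap ev sequentially) \<noteq> bot"
    using cpt[unfolded compact_filter, THEN spec, of "filtermap ev sequentially"] by auto
  define F where "F = inf (filtercomap ev (nhds x)) sequentially"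
  have "F \<noteq> bot"
  proof
    assume "F = bot"
    then have "eventually (\<lambda>_. False) F" by simp
    then obtain P Q where P: "eventually P (filtercomap ev (nhds x))" and Q: "eventually Q sequentially"
      and PQ: "\<And>n. P n \<Longrightarrow> Q n \<Longrightarrow> False"
      unfolding F_def eventually_inf by blast
    then obtain P' where P': "eventually P' (nhds x)" "\<And>n. P' (ev n) \<Longrightarrow> P n"
      unfolding eventually_filtercomap by blast
    have "eventually (\<lambda>y. \<not> P' y) (filtermap ev sequentially)"
      unfolding eventually_filtermap using Q by (rule eventually_mono) (use P' PQ in blast)
    with P'(1) have "eventually (\<lambda>_. False) (inf (nhds x) (filtermap ev sequentially))"
      unfolding eventually_inf by blast
    with x show False by (simp add: trivial_limit_def)
  qed
  moreover have "F \<le> sequentially" by (simp add: F_def)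
  moreover have "(b \<longlongrightarrow> x b) F" for b
  proof -
    have "filterlim ev (nhds x) F"
      unfolding F_def by (rule filterlim_mono[OF filterlim_filtercomap order_refl]) simp
    moreover have "filterlim (\<lambda>y. y b) (nhds (x b)) (nhds x)"
      unfolding filterlim_iff
    proof (intro allI impI)
      fix P assume "eventually P (nhds (x b))"
      then obtain S where S: "open S" "x b \<in> S" "\<And>z. z \<in> S \<Longrightarrow> P z"
        unfolding eventually_nhds by blast
      have "open ((\<lambda>y. y b) -` S :: ((nat \<Rightarrow> ennreal) \<Rightarrow> ennreal) set)"
        using S(1) by (intro open_vimage continuous_on_product_coordinates)
      then show "eventually (\<lambda>y. P (y b)) (nhds x)"
        unfolding eventually_nhds using S by (intro exI[of _ "(\<lambda>y. y b) -` S"]) auto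
    qed
    ultimately have "((\<lambda>n. ev n b) \<longlongrightarrow> x b) F" by (rule filterlim_compose[rotated])
    then show ?thesis by (simp add: ev_def)
  qed
  ultimately show ?thesis by (intro exI[of _ F] total_limit.intro) auto
qed

section \<open>Vague limits of measures\<close>

text \<open>
  Both inequalities together are the portmanteau form of vague convergence, which avoids test
  functions. They determine a Radon measure on a locally compact Hausdorff space
  (\<open>vague_limit_unique\<close>).
\<close>

definition vague_limit :: "'a topology \<Rightarrow> nat filter \<Rightarrow> (nat \<Rightarrow> 'a measure) \<Rightarrow> 'a measure \<Rightarrow> bool" where
  "vague_limit T F \<alpha> M \<longleftrightarrow>
    (\<forall>U. openin T U \<longrightarrow> emeasure M U \<le> Lim F (\<lambda>n. emeasure (\<alpha> n) U)) \<and>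
    (\<forall>K. compactin T K \<longrightarrow> Lim F (\<lambda>n. emeasure (\<alpha> n) K) \<le> emeasure M K)"

lemma locally_compact_Hausdorff_compact_between:
  assumes T: "Hausdorff_space T" and lc: "locally_compact_space T"
    and K: "compactin T K" and U: "openin T U" "K \<subseteq> U"
  obtains V L where "openin T V" "compactin T L" "K \<subseteq> V" "V \<subseteq> L" "L \<subseteq> U"
proof -
  have nb: "neighbourhood_base_of (compactin T) T"
    using lc T locally_compact_space_neighbourhood_base by blast
  define \<V> where "\<V> = {V. openin T V \<and> (\<exists>L. compactin T L \<and> V \<subseteq> L \<and> L \<subseteq> U)}"
  have "\<exists>V\<in>\<V>. x \<in> V" if "x \<in> K" for x
  proof -
    have xU: "x \<in> U" using that U(2) by blast
    obtain V D where "openin T V" "compactin T D" "x \<in> V" "V \<subseteq> D" "D \<subseteq> U"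
      using nb[unfolded neighbourhood_base_of, THEN spec, THEN spec, THEN mp, OF conjI, OF U(1) xU]
      by (elim exE conjE)
    then show ?thesis unfolding \<V>_def by blast
  qed
  then have "K \<subseteq> \<Union>\<V>" by blast
  moreover have "openin T V" if "V \<in> \<V>" for V using that by (simp add: \<V>_def)
  ultimately have "\<exists>F. finite F \<and> F \<subseteq> \<V> \<and> K \<subseteq> \<Union>F" by (intro compactinD[OF K])
  then obtain F where F: "finite F" "F \<subseteq> \<V>" "K \<subseteq> \<Union>F" by blast
  have "\<forall>V\<in>F. \<exists>L. compactin T L \<and> V \<subseteq> L \<and> L \<subseteq> U" using F(2) unfolding \<V>_def by blast
  from bchoice[OF this] obtain L where L: "\<forall>V\<in>F. compactin T (L V) \<and> V \<subseteq> L V \<and> L V \<subseteq> U" ..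
  show ?thesis
  proof (rule that[of "\<Union>F" "\<Union>V\<in>F. L V"])
    show "openin T (\<Union>F)" using F(2) by (auto simp: \<V>_def)
    show "compactin T (\<Union>V\<in>F. L V)" using F(1) L by (intro compactin_Union) auto
  qed (use F(3) L in blast)+
qed

context total_limit
begin

text \<open>
  On compact sets, the limits of the measures form a content.
\<close>

lemma ex_vague_limit:
  assumes T: "Hausdorff_space T" and sets: "\<And>n. sets (\<alpha> n) = sets (borel_of T)"
    and le1: "\<And>n. emeasure (\<alpha> n) (topspace T) \<le> 1"
  obtains M where "radon_subprob T M" "vague_limit T F \<alpha> M"
proof -
  define c where "c K = Lim F (\<lambda>n. emeasure (\<alpha> n) K)" for K
  have cpt: "K \<in> sets (\<alpha> n)" if "compactin T K" for K n
    using that T by (simp add: sets compactin_sets_borel_of)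
  have le1': "emeasure (\<alpha> n) E \<le> 1" for n E
    using order_trans[OF emeasure_space[of "\<alpha> n" E], of 1] le1[of n] sets_eq_imp_space_eq[OF sets[of n]]
    by simp
  interpret compact_content T c
  proof
    show "Hausdorff_space T" by (rule T)
    show "c {} = 0" by (simp add: c_def Lim_const)
    fix K L assume KL: "compactin T K" "compactin T L"
    show "c K \<le> 1" using Lim_mono[of "\<lambda>n. emeasure (\<alpha> n) K" "\<lambda>n. 1"] le1' by (simp add: c_def Lim_const)
    show "c K \<le> c L" if "K \<subseteq> L"
      unfolding c_def using that cpt KL by (intro Lim_mono always_eventually allI emeasure_mono) auto
    show "c (K \<union> L) \<le> c K + c L"
      unfolding c_def Lim_add[symmetric]
      using cpt KL by (intro Lim_mono always_eventually allI emeasure_subadditive) auto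
    show "c K + c L \<le> c (K \<union> L)" if "K \<inter> L = {}"
      unfolding c_def Lim_add[symmetric]
      using cpt KL that by (intro Lim_mono always_eventually allI) (simp add: plus_emeasure)
  qed
  obtain M where M: "radon_subprob T M" "\<And>U. openin T U \<Longrightarrow> emeasure M U = inner_content U"
    "\<And>K. compactin T K \<Longrightarrow> c K \<le> emeasure M K" using radon_extension by blast
  have "inner_content U \<le> Lim F (\<lambda>n. emeasure (\<alpha> n) U)" if U: "openin T U" for U
  proof (rule inner_content_leI)
    fix K assume "compactin T K" "K \<subseteq> U"
    then show "c K \<le> Lim F (\<lambda>n. emeasure (\<alpha> n) U)"
      unfolding c_def using U by (intro Lim_mono always_eventually allI emeasure_mono)
        (auto simp: sets openin_sets_borel_of)
  qed
  then have "vague_limit T F \<alpha> M" using M(2,3) by (simp add: vague_limit_def c_def)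
  with M(1) show ?thesis by (rule that)
qed

text \<open>
  Between a compact set and an open neighbourhood of it there is room for an open set with
  compact closure; the two defining inequalities are applied to these two sets, one for each
  measure.
\<close>

lemma vague_limit_le:
  assumes T: "Hausdorff_space T" and lc: "locally_compact_space T"
    and sets: "\<And>n. sets (\<alpha> n) = sets (borel_of T)"
    and M: "radon_subprob T M" "vague_limit T F \<alpha> M" and N: "radon_subprob T N" "vague_limit T F \<alpha> N"
    and K: "compactin T K"
  shows "emeasure M K \<le> emeasure N K"
proof (rule ennreal_le_epsilon)
  fix e :: real assume "0 < e"
  obtain U where U: "openin T U" "K \<subseteq> U" "emeasure N U \<le> emeasure N K + ennreal e"
    using radon_subprob_outer_approx[OF T N(1) compactin_sets_borel_of[OF T K] \<open>0 < e\<close>] .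
  obtain V L where VL: "openin T V" "compactin T L" "K \<subseteq> V" "V \<subseteq> L" "L \<subseteq> U"
    using locally_compact_Hausdorff_compact_between[OF T lc K U(1,2)] .
  have sets': "V \<in> sets (\<alpha> n)" "L \<in> sets (\<alpha> n)" for n
    using VL T by (auto simp: sets openin_sets_borel_of compactin_sets_borel_of)
  have "emeasure M K \<le> emeasure M V"
    using VL by (intro emeasure_mono) (auto simp: radon_subprob_sets[OF M(1)] openin_sets_borel_of)
  also have "\<dots> \<le> Lim F (\<lambda>n. emeasure (\<alpha> n) V)" using M(2) VL(1) by (simp add: vague_limit_def)
  also have "\<dots> \<le> Lim F (\<lambda>n. emeasure (\<alpha> n) L)"
    using VL(4) sets' by (intro Lim_mono always_eventually allI emeasure_mono) auto
  also have "\<dots> \<le> emeasure N L" using N(2) VL(2) by (simp add: vague_limit_def)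
  also have "\<dots> \<le> emeasure N U"
    using VL U by (intro emeasure_mono) (auto simp: radon_subprob_sets[OF N(1)] openin_sets_borel_of)
  also note U(3)
  finally show "emeasure M K \<le> emeasure N K + ennreal e" .
qed

lemma vague_limit_unique:
  assumes "Hausdorff_space T" "locally_compact_space T" "\<And>n. sets (\<alpha> n) = sets (borel_of T)"
    and "radon_subprob T M" "vague_limit T F \<alpha> M" "radon_subprob T N" "vague_limit T F \<alpha> N"
  shows "M = N"
proof (rule radon_subprob_eqI[OF assms(1,4,6)], rule antisym)
  fix K assume K: "compactin T K"
  show "emeasure M K \<le> emeasure N K"
    by (rule vague_limit_le[OF assms K])
  show "emeasure N K \<le> emeasure M K"
    by (rule vague_limit_le[OF assms(1-3) assms(6,7) assms(4,5) K])
qed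

end

section \<open>Convolution is vaguely continuous\<close>

context locally_compact_group
begin

lemma carrier_sets: "carrier G \<in> sets (borel_of T)"
  using openin_sets_borel_of[OF openin_topspace, of T] by (simp add: topspace_eq)

lemma radon_space: "radon_subprob T \<alpha> \<Longrightarrow> space \<alpha> = carrier G"
  by (simp add: radon_subprob_space topspace_eq)

text \<open>
  Upper semicontinuity, by passing to the complement of \<open>K\<close>. The case distinction is due to
  the truncated subtraction: if \<open>t\<close> exceeds the total mass, then no \<open>x\<close> reaches the level \<open>t\<close>.
\<close>

lemma closed_superlevel_translate:
  assumes \<alpha>: "radon_subprob T \<alpha>" and K: "closedin T K"
  shows "closedin T {x \<in> carrier G. t \<le> emeasure \<alpha> (translate_preimage K x)}"
proof -
  let ?f = "\<lambda>E x. emeasure \<alpha> (translate_preimage E x)"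
  have U: "openin T (carrier G - K)" using K by (simp add: closedin_def topspace_eq)
  have add: "?f K x + ?f (carrier G - K) x = emeasure \<alpha> (carrier G)" if x: "x \<in> carrier G" for x
  proof -
    have "translate_preimage K x \<union> translate_preimage (carrier G - K) x = carrier G"
      using x by auto
    moreover have "translate_preimage K x \<inter> translate_preimage (carrier G - K) x = {}" by auto
    ultimately show ?thesis
      using plus_emeasure[of "translate_preimage K x" \<alpha> "translate_preimage (carrier G - K) x"]
        translate_preimage_sets[OF closedin_sets_borel_of[OF K] x]
        translate_preimage_sets[OF openin_sets_borel_of[OF U] x]
      by (simp only: radon_subprob_sets[OF \<alpha>])
  qed
  have "openin T {x \<in> carrier G. ?f K x < t}"
  proof (cases "emeasure \<alpha> (carrier G) < t")
    case True
    have "?f K x < t" if "x \<in> carrier G" for x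
    proof (rule le_less_trans[OF _ True])
      show "?f K x \<le> emeasure \<alpha> (carrier G)" using add[OF that, symmetric] by simp
    qed
    then have "{x \<in> carrier G. ?f K x < t} = topspace T" by (auto simp: topspace_eq)
    then show ?thesis by simp
  next
    case False
    have "?f K x < t \<longleftrightarrow> emeasure \<alpha> (carrier G) - t < ?f (carrier G - K) x" if x: "x \<in> carrier G" for x
    proof -
      have fin: "emeasure \<alpha> (carrier G) \<noteq> \<top>" "?f K x \<noteq> \<top>" "?f (carrier G - K) x \<noteq> \<top>"
        using radon_subprob_neq_top[OF \<alpha>] by auto
      obtain m where m: "emeasure \<alpha> (carrier G) = ennreal m" "0 \<le> m"
        using fin(1) by (cases "emeasure \<alpha> (carrier G)") auto
      obtain k where k: "?f K x = ennreal k" "0 \<le> k"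
        using fin(2) by (cases "?f K x") auto
      obtain g where g: "?f (carrier G - K) x = ennreal g" "0 \<le> g"
        using fin(3) by (cases "?f (carrier G - K) x") auto
      note mkg = m k g
      have "t \<noteq> \<top>" using False fin(1) by (auto simp: less_top not_less top_unique)
      then obtain s where s: "t = ennreal s" "0 \<le> s" by (cases t) auto
      have "ennreal (k + g) = ennreal m" using add[OF x] k g m by (simp only: ennreal_plus)
      then have "m = k + g" using k g m by (simp del: ennreal_plus)
      moreover have "s \<le> m" using False m s by (simp only: not_less ennreal_le_iff)
      ultimately show ?thesis
        using mkg s by (auto simp: ennreal_less_iff ennreal_minus simp flip: ennreal_plus)
    qed
    then have "{x \<in> carrier G. ?f K x < t} =
        {x \<in> carrier G. emeasure \<alpha> (carrier G) - t < ?f (carrier G - K) x}" by auto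
    then show ?thesis using open_superlevel_translate[OF \<alpha> U] by simp
  qed
  moreover have "carrier G - {x \<in> carrier G. t \<le> ?f K x} = {x \<in> carrier G. ?f K x < t}" by auto
  ultimately show ?thesis by (auto simp: closedin_def topspace_eq)
qed

text \<open>
  If \<open>L\<close> is a compact set that misses less than \<open>t\<close> of the mass of \<open>\<alpha>\<close>, then \<open>Kx\<^sup>-\<^sup>1\<close> can have
  measure \<open>t\<close> only if it meets \<open>L\<close>, which confines \<open>x\<close> to the compact set \<open>L\<^sup>-\<^sup>1K\<close>. So
  \<open>x \<mapsto> \<alpha>(Kx\<^sup>-\<^sup>1)\<close> vanishes at infinity, and mass that escapes to infinity in a vague limit
  does not disturb convolution by \<open>\<alpha>\<close>.
\<close>

lemma compactin_superlevel_translate: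
  assumes \<alpha>: "radon_subprob T \<alpha>" and K: "compactin T K" and t: "0 < (t::real)"
  shows "compactin T {x \<in> carrier G. ennreal t \<le> emeasure \<alpha> (translate_preimage K x)}"
proof -
  obtain L where L: "compactin T L" "L \<subseteq> carrier G"
    and le: "emeasure \<alpha> (carrier G) \<le> emeasure \<alpha> L + ennreal (t / 2)"
    using radon_subprob_open_approx[OF \<alpha> openin_topspace, of "t / 2"] t by (auto simp: topspace_eq)
  have Kc: "K \<subseteq> carrier G" using compactin_subset_topspace[OF K] by (simp add: topspace_eq)
  define C where "C = (\<lambda>(x, y). x \<otimes> y) ` ((\<lambda>x. inv x) ` L \<times> K)"
  have C: "compactin T C"
    unfolding C_def by (rule compact_mult_image[OF image_compactin[OF L(1) continuous_inv] K])
  have "{x \<in> carrier G. ennreal t \<le> emeasure \<alpha> (translate_preimage K x)} \<subseteq> C"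
  proof safe
    fix x assume x: "x \<in> carrier G" and ge: "ennreal t \<le> emeasure \<alpha> (translate_preimage K x)"
    have meas: "translate_preimage K x \<in> sets \<alpha>" "L \<in> sets \<alpha>"
      using translate_preimage_sets[OF compactin_sets_borel_of[OF Hausdorff K] x]
        compactin_sets_borel_of[OF Hausdorff L(1)]
      by (auto simp: radon_subprob_sets[OF \<alpha>])
    have "translate_preimage K x \<inter> L \<noteq> {}"
    proof
      assume disj: "translate_preimage K x \<inter> L = {}"
      have "ennreal t + emeasure \<alpha> L \<le> emeasure \<alpha> (translate_preimage K x) + emeasure \<alpha> L"
        using ge by (rule add_right_mono)
      also have "\<dots> = emeasure \<alpha> (translate_preimage K x \<union> L)"
        using meas disj by (intro plus_emeasure) auto
      also have "\<dots> \<le> emeasure \<alpha> (carrier G)"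
        using L carrier_sets by (intro emeasure_mono) (auto simp: radon_subprob_sets[OF \<alpha>])
      also note le
      finally have *: "ennreal t + emeasure \<alpha> L \<le> emeasure \<alpha> L + ennreal (t / 2)" .
      obtain l where "emeasure \<alpha> L = ennreal l" "0 \<le> l"
        using radon_subprob_neq_top[OF \<alpha>, of L] by (cases "emeasure \<alpha> L") auto
      with * t show False by (simp flip: ennreal_plus)
    qed
    then obtain y where y: "y \<in> L" "y \<otimes> x \<in> K" by auto
    then have "x = inv y \<otimes> (y \<otimes> x)" using x L(2) by (simp add: inv_solve_left subset_iff)
    then show "x \<in> C" unfolding C_def using y by force
  qed
  then show ?thesis
    using closed_superlevel_translate[OF \<alpha> compactin_imp_closedin[OF Hausdorff K], of "ennreal t"]
    by (intro closed_compactin[OF C])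
qed

text \<open>
  The integrand \<open>x \<mapsto> \<mu>(Ex\<^sup>-\<^sup>1)\<close> has open superlevel sets for open \<open>E\<close> and compact superlevel
  sets for compact \<open>E\<close>. On these the limit measure satisfies the defining inequalities, and
  the layer cake bounds carry them over to the integrals.
\<close>

lemma vague_limit_conv:
  assumes F: "total_limit F" and \<mu>: "radon_subprob T \<mu>"
    and \<alpha>: "\<And>n. radon_subprob T (\<alpha> n)" and M: "radon_subprob T M" and lim: "vague_limit T F \<alpha> M"
  shows "vague_limit T F (\<lambda>n. conv \<mu> (\<alpha> n)) (conv \<mu> M)"
proof -
  interpret total_limit F by (rule F)
  let ?f = "\<lambda>E x. emeasure \<mu> (translate_preimage E x)"
  have f1: "?f E x \<le> 1" for E x by (rule radon_subprob_le_1[OF \<mu>])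
  have meas: "?f E \<in> borel_measurable \<beta>" if "radon_subprob T \<beta>" "E \<in> sets (borel_of T)" for E \<beta>
    using measurable_emeasure_translate[OF \<mu> that(2)]
      measurable_cong_sets[OF radon_subprob_sets[OF that(1)] refl] by blast
  have conv: "emeasure (conv \<mu> \<beta>) E = (\<integral>\<^sup>+ x. ?f E x \<partial>\<beta>)"
    if "radon_subprob T \<beta>" "E \<in> sets (borel_of T)" for E \<beta>
    using emeasure_conv[OF \<mu> radon_subprob_sets[OF that(1)] that(2)] .
  have inverse_small: "\<exists>n::nat. 0 < n \<and> ennreal (1 / real n) \<le> ennreal e" if "0 < e" for e :: real
  proof -
    obtain n :: nat where "0 < n" "1 / real n < e" using \<open>0 < e\<close> by (metis nat_approx_posE zero_less_Suc)
    then show ?thesis by (intro exI[of _ n]) (simp add: ennreal_leI)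
  qed
  show ?thesis
    unfolding vague_limit_def
  proof (intro conjI allI impI)
    fix U assume U: "openin T U"
    note Usets = openin_sets_borel_of[OF U]
    have "emeasure (conv \<mu> M) U \<le> Lim F (\<lambda>n. emeasure (conv \<mu> (\<alpha> n)) U)"
    proof (rule ennreal_le_epsilon)
      fix e :: real assume "0 < e"
      then obtain n :: nat where n: "0 < n" "ennreal (1 / real n) \<le> ennreal e" using inverse_small by blast
      define A where "A i = {x \<in> carrier G. ennreal (real i / real n) < ?f U x}" for i :: nat
      have A: "openin T (A i)" for i unfolding A_def by (rule open_superlevel_translate[OF \<mu> U])
      have bounds: "(\<Sum>i=1..n. emeasure \<beta> (A i)) * ennreal (1 / real n) \<le> (\<integral>\<^sup>+x. ?f U x \<partial>\<beta>)"
        "(\<integral>\<^sup>+x. ?f U x \<partial>\<beta>) \<le> (\<Sum>i=1..n. emeasure \<beta> (A i)) * ennreal (1 / real n)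
           + emeasure \<beta> (space \<beta>) * ennreal (1 / real n)" if \<beta>: "radon_subprob T \<beta>" for \<beta>
        by (rule level_set_sum_bounds[OF meas[OF \<beta> Usets] f1 n(1)];
          use openin_sets_borel_of[OF A] in \<open>auto simp: A_def radon_space[OF \<beta>] radon_subprob_sets[OF \<beta>]\<close>)+
      have "emeasure (conv \<mu> M) U \<le> (\<Sum>i=1..n. emeasure M (A i)) * ennreal (1 / real n)
           + emeasure M (space M) * ennreal (1 / real n)"
        unfolding conv[OF M Usets] by (rule bounds(2)[OF M])
      also have "\<dots> \<le> (\<Sum>i=1..n. Lim F (\<lambda>m. emeasure (\<alpha> m) (A i))) * ennreal (1 / real n) + 1 * ennreal e"
        using lim A unfolding vague_limit_def
        by (intro add_mono mult_mono sum_mono n radon_subprob_le_1[OF M]) auto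
      also have "(\<Sum>i=1..n. Lim F (\<lambda>m. emeasure (\<alpha> m) (A i))) * ennreal (1 / real n) =
          Lim F (\<lambda>m. (\<Sum>i=1..n. emeasure (\<alpha> m) (A i)) * ennreal (1 / real n))"
        by (simp add: Lim_mult_ennreal Lim_sum)
      also have "\<dots> \<le> Lim F (\<lambda>m. emeasure (conv \<mu> (\<alpha> m)) U)"
        unfolding conv[OF \<alpha> Usets] by (intro Lim_mono always_eventually allI bounds(1) \<alpha>)
      finally show "emeasure (conv \<mu> M) U \<le> Lim F (\<lambda>n. emeasure (conv \<mu> (\<alpha> n)) U) + ennreal e"
        by (simp add: add_right_mono)
    qed
    then show "emeasure (conv \<mu> M) U \<le> Lim F (\<lambda>n. emeasure (conv \<mu> (\<alpha> n)) U)" .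
  next
    fix K assume K: "compactin T K"
    note Ksets = compactin_sets_borel_of[OF Hausdorff K]
    show "Lim F (\<lambda>n. emeasure (conv \<mu> (\<alpha> n)) K) \<le> emeasure (conv \<mu> M) K"
    proof (rule ennreal_le_epsilon)
      fix e :: real assume "0 < e"
      then obtain n :: nat where n: "0 < n" "ennreal (1 / real n) \<le> ennreal e" using inverse_small by blast
      define A where "A i = {x \<in> carrier G. ennreal (real i / real n) \<le> ?f K x}" for i :: nat
      have A: "compactin T (A i)" if "i \<in> {1..n}" for i
        unfolding A_def using that n(1) by (intro compactin_superlevel_translate[OF \<mu> K]) simp
      have bounds: "(\<Sum>i=1..n. emeasure \<beta> (A i)) * ennreal (1 / real n) \<le> (\<integral>\<^sup>+x. ?f K x \<partial>\<beta>)"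
        "(\<integral>\<^sup>+x. ?f K x \<partial>\<beta>) \<le> (\<Sum>i=1..n. emeasure \<beta> (A i)) * ennreal (1 / real n)
           + emeasure \<beta> (space \<beta>) * ennreal (1 / real n)" if \<beta>: "radon_subprob T \<beta>" for \<beta>
        by (rule level_set_sum_bounds[OF meas[OF \<beta> Ksets] f1 n(1)];
          use compactin_sets_borel_of[OF Hausdorff A] in \<open>auto simp: A_def radon_space[OF \<beta>] radon_subprob_sets[OF \<beta>]\<close>)+
      have "Lim F (\<lambda>m. emeasure (conv \<mu> (\<alpha> m)) K) \<le>
          Lim F (\<lambda>m. (\<Sum>i=1..n. emeasure (\<alpha> m) (A i)) * ennreal (1 / real n) + ennreal e)"
      proof (intro Lim_mono always_eventually allI)
        fix m
        have "emeasure (conv \<mu> (\<alpha> m)) K \<le> (\<Sum>i=1..n. emeasure (\<alpha> m) (A i)) * ennreal (1 / real n)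
           + emeasure (\<alpha> m) (space (\<alpha> m)) * ennreal (1 / real n)"
          unfolding conv[OF \<alpha> Ksets] by (rule bounds(2)[OF \<alpha>])
        also have "\<dots> \<le> (\<Sum>i=1..n. emeasure (\<alpha> m) (A i)) * ennreal (1 / real n) + 1 * ennreal e"
          by (intro add_left_mono mult_mono n radon_subprob_le_1[OF \<alpha>]) auto
        finally show "emeasure (conv \<mu> (\<alpha> m)) K \<le>
            (\<Sum>i=1..n. emeasure (\<alpha> m) (A i)) * ennreal (1 / real n) + ennreal e" by simp
      qed
      also have "\<dots> = (\<Sum>i=1..n. Lim F (\<lambda>m. emeasure (\<alpha> m) (A i))) * ennreal (1 / real n) + ennreal e"
        by (simp add: Lim_add Lim_const Lim_mult_ennreal Lim_sum)
      also have "\<dots> \<le> (\<Sum>i=1..n. emeasure M (A i)) * ennreal (1 / real n) + ennreal e"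
        using lim A unfolding vague_limit_def by (intro add_right_mono mult_right_mono sum_mono) auto
      also have "\<dots> \<le> emeasure (conv \<mu> M) K + ennreal e"
        unfolding conv[OF M Ksets] by (intro add_right_mono bounds(1) M)
      finally show "Lim F (\<lambda>n. emeasure (conv \<mu> (\<alpha> n)) K) \<le> emeasure (conv \<mu> M) K + ennreal e" .
    qed
  qed
qed

end

section \<open>Dissipation and invariant chains\<close>

context locally_compact_group
begin

lemma radon_subprob_return:
  assumes x: "x \<in> carrier G" shows "radon_subprob T (return (borel_of T) x)"
proof (rule radon_subprobI)
  show "emeasure (return (borel_of T) x) (topspace T) \<le> 1"
    using carrier_sets by (simp add: topspace_eq indicator_def)
  fix U and e :: real assume U: "openin T U" "0 < e"
  show "\<exists>K. compactin T K \<and> K \<subseteq> U \<and>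
      emeasure (return (borel_of T) x) U \<le> emeasure (return (borel_of T) x) K + ennreal e"
  proof (intro exI conjI)
    show "compactin T (U \<inter> {x})" using x by (intro finite_imp_compactin) (auto simp: topspace_eq)
    then show "emeasure (return (borel_of T) x) U \<le> emeasure (return (borel_of T) x) (U \<inter> {x}) + ennreal e"
      using U by (simp add: openin_sets_borel_of compactin_sets_borel_of Hausdorff indicator_def)
  qed simp
qed simp

lemma emeasure_conv_return:
  assumes \<alpha>: "radon_subprob T \<alpha>" and x: "x \<in> carrier G" and E: "E \<in> sets (borel_of T)"
  shows "emeasure (conv \<alpha> (return (borel_of T) x)) E = emeasure \<alpha> (translate_preimage E x)"
  using x by (subst emeasure_conv[OF \<alpha> _ E])
    (auto simp: topspace_eq nn_integral_return measurable_emeasure_translate[OF \<alpha> E])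

lemma conv_return_one:
  assumes \<alpha>: "radon_subprob T \<alpha>" shows "conv \<alpha> (return (borel_of T) \<one>) = \<alpha>"
proof (rule measure_eqI)
  show "sets (conv \<alpha> (return (borel_of T) \<one>)) = sets \<alpha>" by (simp add: radon_subprob_sets[OF \<alpha>])
  fix E assume "E \<in> sets (conv \<alpha> (return (borel_of T) \<one>))"
  then have E: "E \<in> sets (borel_of T)" by simp
  have "translate_preimage E \<one> = E" using sets.sets_into_space[OF E] by (auto simp: topspace_eq)
  then show "emeasure (conv \<alpha> (return (borel_of T) \<one>)) E = emeasure \<alpha> E"
    by (simp add: emeasure_conv_return[OF \<alpha> one_closed E])
qed

lemma return_one_conv:
  assumes \<alpha>: "radon_subprob T \<alpha>" shows "conv (return (borel_of T) \<one>) \<alpha> = \<alpha>"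
proof (rule measure_eqI)
  show "sets (conv (return (borel_of T) \<one>) \<alpha>) = sets \<alpha>" by (simp add: radon_subprob_sets[OF \<alpha>])
  fix E assume "E \<in> sets (conv (return (borel_of T) \<one>) \<alpha>)"
  then have E: "E \<in> sets (borel_of T)" by simp
  have "emeasure (conv (return (borel_of T) \<one>) \<alpha>) E =
      (\<integral>\<^sup>+ x. emeasure (return (borel_of T) \<one>) (translate_preimage E x) \<partial>\<alpha>)"
    by (rule emeasure_conv[OF radon_subprob_return[OF one_closed] radon_subprob_sets[OF \<alpha>] E])
  also have "\<dots> = (\<integral>\<^sup>+ x. indicator E x \<partial>\<alpha>)"
    using translate_preimage_sets[OF E]
    by (intro nn_integral_cong) (auto simp: radon_space[OF \<alpha>] indicator_def)
  also have "\<dots> = emeasure \<alpha> E" using E by (simp add: radon_subprob_sets[OF \<alpha>])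
  finally show "emeasure (conv (return (borel_of T) \<one>) \<alpha>) E = emeasure \<alpha> E" .
qed

abbreviation conv_power :: "'a measure \<Rightarrow> nat \<Rightarrow> 'a measure" where
  "conv_power \<equiv> convolution_power G T"

lemma radon_subprob_conv_power: "radon_subprob T \<rho> \<Longrightarrow> radon_subprob T (conv_power \<rho> n)"
  by (induction n) (auto intro: radon_subprob_return radon_subprob_conv)

lemma conv_power_Suc_left:
  assumes \<rho>: "radon_subprob T \<rho>" shows "conv \<rho> (conv_power \<rho> n) = conv_power \<rho> (Suc n)"
proof (induction n)
  case 0
  show ?case by (simp add: conv_return_one[OF \<rho>] return_one_conv[OF \<rho>])
next
  case (Suc n)
  then show ?case
    by (simp add: conv_assoc[OF \<rho> radon_subprob_conv_power[OF \<rho>] \<rho>, symmetric])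
qed

lemma r_coset_eq: "C \<subseteq> carrier G \<Longrightarrow> x \<in> carrier G \<Longrightarrow> C #> x = translate_preimage C (inv x)"
  using r_coset_inv_eq[of C "inv x"] by simp

definition concentration :: "'a measure \<Rightarrow> 'a set \<Rightarrow> nat \<Rightarrow> ennreal" where
  "concentration \<rho> C n = (SUP x\<in>carrier G. emeasure (conv_power \<rho> n) (C #> x))"

text \<open>
  The number \<open>\<rho>\<^sup>n\<^sup>+\<^sup>1(Cx)\<close> is the integral of \<open>\<rho>\<^sup>n(Cxy\<^sup>-\<^sup>1)\<close> over \<open>y\<close> against \<open>\<rho>\<close>, which has
  mass at most one.
\<close>

lemma decseq_concentration:
  assumes \<rho>: "radon_subprob T \<rho>" and C: "compactin T C"
  shows "decseq (concentration \<rho> C)"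
proof (rule decseq_SucI)
  fix n
  have Cc: "C \<subseteq> carrier G" using compactin_subset_topspace[OF C] by (simp add: topspace_eq)
  note \<rho>n = radon_subprob_conv_power[OF \<rho>, of n]
  show "concentration \<rho> C (Suc n) \<le> concentration \<rho> C n"
    unfolding concentration_def[of \<rho> C "Suc n"]
  proof (rule SUP_least)
    fix x assume x: "x \<in> carrier G"
    have sets: "C #> x \<in> sets (borel_of T)"
      unfolding r_coset_eq[OF Cc x] using x
      by (intro translate_preimage_sets compactin_sets_borel_of[OF Hausdorff C]) simp
    have "emeasure (conv_power \<rho> (Suc n)) (C #> x) =
        (\<integral>\<^sup>+ y. emeasure (conv_power \<rho> n) (translate_preimage (C #> x) y) \<partial>\<rho>)"
      by (simp add: emeasure_conv[OF \<rho>n radon_subprob_sets[OF \<rho>] sets])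
    also have "\<dots> \<le> (\<integral>\<^sup>+ y. concentration \<rho> C n \<partial>\<rho>)"
    proof (rule nn_integral_mono)
      fix y assume "y \<in> space \<rho>"
      then have y: "y \<in> carrier G" by (simp add: radon_space[OF \<rho>])
      have "translate_preimage (C #> x) y = C #> (x \<otimes> inv y)"
        using x y Cc by (simp add: r_coset_inv_eq[symmetric] r_coset_subset_G coset_mult_assoc)
      then show "emeasure (conv_power \<rho> n) (translate_preimage (C #> x) y) \<le> concentration \<rho> C n"
        unfolding concentration_def using x y by (auto intro!: SUP_upper)
    qed
    also have "\<dots> \<le> concentration \<rho> C n * 1"
      by (simp add: mult_left_mono radon_subprob_le_1[OF \<rho>] del: mult_1_right)
    finally show "emeasure (conv_power \<rho> (Suc n)) (C #> x) \<le> concentration \<rho> C n" by simp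
  qed
qed

text \<open>
  The group version of a solution. It suffices to ask for nonzero mass at time 0, since
  convolution with a probability measure preserves mass and all members of the chain then have
  the same one.
\<close>

definition invariant_chain :: "'a measure \<Rightarrow> (int \<Rightarrow> 'a measure) \<Rightarrow> bool" where
  "invariant_chain \<rho> \<Lambda> \<longleftrightarrow>
    (\<forall>k. radon_subprob T (\<Lambda> k)) \<and> (\<forall>k. \<Lambda> k = conv \<rho> (\<Lambda> (k - 1))) \<and> emeasure (\<Lambda> 0) (carrier G) \<noteq> 0"

lemma invariant_chainD:
  assumes "invariant_chain \<rho> \<Lambda>"
  shows "radon_subprob T (\<Lambda> k)" "\<Lambda> k = conv \<rho> (\<Lambda> (k - 1))" "emeasure (\<Lambda> 0) (carrier G) \<noteq> 0"
  using assms unfolding invariant_chain_def by blast+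

lemma invariant_chain_conv_power:
  assumes \<rho>: "radon_subprob T \<rho>" and \<Lambda>: "invariant_chain \<rho> \<Lambda>"
  shows "\<Lambda> 0 = conv (conv_power \<rho> n) (\<Lambda> (- int n))"
proof (induction n)
  case 0
  show ?case by (simp add: return_one_conv invariant_chainD(1)[OF \<Lambda>])
next
  case (Suc n)
  have "\<Lambda> (- int n) = conv \<rho> (\<Lambda> (- int n - 1))" by (rule invariant_chainD(2)[OF \<Lambda>])
  also have "- int n - 1 = - int (Suc n)" by simp
  finally have "\<Lambda> 0 = conv (conv_power \<rho> n) (conv \<rho> (\<Lambda> (- int (Suc n))))"
    using Suc by (simp only:)
  also have "\<dots> = conv (conv_power \<rho> (Suc n)) (\<Lambda> (- int (Suc n)))"
    using conv_assoc[OF radon_subprob_conv_power[OF \<rho>, of n] \<rho> invariant_chainD(1)[OF \<Lambda>]] by simp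
  finally show ?case .
qed

lemma invariant_chain_imp_not_dissipating:
  assumes \<rho>: "radon_subprob T \<rho>" and \<Lambda>: "invariant_chain \<rho> \<Lambda>"
  shows "\<not> dissipating G T \<rho>"
proof
  assume diss: "dissipating G T \<rho>"
  note \<Lambda>r = invariant_chainD(1)[OF \<Lambda>]
  have "0 < emeasure (\<Lambda> 0) (topspace T)"
    using invariant_chainD(3)[OF \<Lambda>] by (simp add: topspace_eq zero_less_iff_neq_zero)
  also have "emeasure (\<Lambda> 0) (topspace T) = (SUP K\<in>{K. compactin T K \<and> K \<subseteq> topspace T}. emeasure (\<Lambda> 0) K)"
    using \<Lambda>r[of 0] openin_topspace[of T] unfolding radon_subprob_def by blast
  finally obtain K where K: "compactin T K" "0 < emeasure (\<Lambda> 0) K" by (auto simp: less_SUP_iff)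
  have Kc: "K \<subseteq> carrier G" using compactin_subset_topspace[OF K(1)] by (simp add: topspace_eq)
  have "emeasure (\<Lambda> 0) K \<le> concentration \<rho> K n" for n
  proof -
    have "emeasure (\<Lambda> 0) K = (\<integral>\<^sup>+ x. emeasure (conv_power \<rho> n) (translate_preimage K x) \<partial>\<Lambda> (- int n))"
      unfolding invariant_chain_conv_power[OF \<rho> \<Lambda>, of n]
      by (rule emeasure_conv[OF radon_subprob_conv_power[OF \<rho>] radon_subprob_sets[OF \<Lambda>r]
          compactin_sets_borel_of[OF Hausdorff K(1)]])
    also have "\<dots> \<le> (\<integral>\<^sup>+ x. concentration \<rho> K n \<partial>\<Lambda> (- int n))"
    proof (rule nn_integral_mono)
      fix x assume "x \<in> space (\<Lambda> (- int n))"
      then have x: "x \<in> carrier G" by (simp add: radon_space[OF \<Lambda>r])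
      then show "emeasure (conv_power \<rho> n) (translate_preimage K x) \<le> concentration \<rho> K n"
        unfolding concentration_def r_coset_inv_eq[OF Kc x, symmetric] by (intro SUP_upper) simp
    qed
    also have "\<dots> \<le> concentration \<rho> K n * 1"
      by (simp add: mult_left_mono radon_subprob_le_1[OF \<Lambda>r] del: mult_1_right)
    finally show ?thesis by simp
  qed
  moreover have "concentration \<rho> K \<longlonglongrightarrow> 0"
    using diss K(1) by (simp add: dissipating_def concentration_def[abs_def])
  ultimately have "emeasure (\<Lambda> 0) K \<le> 0" by (intro LIMSEQ_le_const) auto
  with K(2) show False by simp
qed

text \<open>
  The chains that start at time \<open>-n\<close> in the point \<open>x\<^sub>n\<^sup>-\<^sup>1\<close> charge \<open>C\<close> with more than \<open>a\<close> at
  time 0, and so do their vague limits for \<open>n \<rightarrow> \<infinity>\<close>, up to equality.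
\<close>

lemma not_dissipating_imp_invariant_chain:
  assumes \<rho>: "radon_subprob T \<rho>" and nd: "\<not> dissipating G T \<rho>"
  shows "\<exists>\<Lambda>. invariant_chain \<rho> \<Lambda>"
proof -
  obtain C where C: "compactin T C" "\<not> concentration \<rho> C \<longlonglongrightarrow> 0"
    using nd by (auto simp: dissipating_def concentration_def[abs_def])
  have Cc: "C \<subseteq> carrier G" using compactin_subset_topspace[OF C(1)] by (simp add: topspace_eq)
  have "concentration \<rho> C \<longlonglongrightarrow> (INF n. concentration \<rho> C n)"
    by (rule LIMSEQ_INF[OF decseq_concentration[OF \<rho> C(1)]])
  with C(2) have "0 < (INF n. concentration \<rho> C n)"
    by (metis not_gr_zero)
  then obtain a where a: "0 < a" "a < (INF n. concentration \<rho> C n)" using dense by blast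
  have "\<exists>x\<in>carrier G. a < emeasure (conv_power \<rho> n) (C #> x)" for n
  proof -
    have "a < concentration \<rho> C n" using a(2) by (rule less_le_trans) (simp add: INF_lower)
    then show ?thesis by (simp add: concentration_def less_SUP_iff)
  qed
  then obtain x where x: "\<And>n. x n \<in> carrier G" "\<And>n. a < emeasure (conv_power \<rho> n) (C #> x n)" by metis
  \<comment> \<open>For \<open>k < - n\<close> the exponent is truncated to 0; for fixed \<open>k\<close> this concerns only finitely many \<open>n\<close>.\<close>
  define \<alpha> where "\<alpha> k n = conv (conv_power \<rho> (nat (k + int n))) (return (borel_of T) (inv (x n)))"
    for k :: int and n
  have \<alpha>: "radon_subprob T (\<alpha> k n)" for k n
    unfolding \<alpha>_def using x by (intro radon_subprob_conv radon_subprob_conv_power \<rho> radon_subprob_return) simp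
  have step: "\<alpha> k n = conv \<rho> (\<alpha> (k - 1) n)" if "nat (1 - k) \<le> n" for k n
  proof -
    have "nat (k + int n) = Suc (nat (k - 1 + int n))" using that by linarith
    then have "\<alpha> k n = conv (conv \<rho> (conv_power \<rho> (nat (k - 1 + int n)))) (return (borel_of T) (inv (x n)))"
      by (simp only: \<alpha>_def conv_power_Suc_left[OF \<rho>])
    also have "\<dots> = conv \<rho> (\<alpha> (k - 1) n)"
      unfolding \<alpha>_def using x by (intro conv_assoc \<rho> radon_subprob_conv_power radon_subprob_return) simp
    finally show ?thesis .
  qed
  obtain F where F: "total_limit F" using ex_total_limit by blast
  then interpret total_limit F .
  have "\<exists>M. radon_subprob T M \<and> vague_limit T F (\<alpha> k) M" for k
    by (rule ex_vague_limit[OF Hausdorff radon_subprob_sets[OF \<alpha>] radon_subprob_le_1[OF \<alpha>]]) (rule exI, rule conjI)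
  then obtain \<Lambda> where "\<forall>k. radon_subprob T (\<Lambda> k) \<and> vague_limit T F (\<alpha> k) (\<Lambda> k)"
    using choice[of "\<lambda>k M. radon_subprob T M \<and> vague_limit T F (\<alpha> k) M"] by blast
  then have \<Lambda>: "\<And>k. radon_subprob T (\<Lambda> k)" "\<And>k. vague_limit T F (\<alpha> k) (\<Lambda> k)" by blast+
  have "\<Lambda> k = conv \<rho> (\<Lambda> (k - 1))" for k
  proof (rule vague_limit_unique[OF Hausdorff locally_compact radon_subprob_sets[OF \<alpha>]])
    have "vague_limit T F (\<lambda>n. conv \<rho> (\<alpha> (k - 1) n)) (conv \<rho> (\<Lambda> (k - 1)))"
      by (rule vague_limit_conv[OF F \<rho> \<alpha> \<Lambda>])
    moreover have "Lim F (\<lambda>n. emeasure (conv \<rho> (\<alpha> (k - 1) n)) E) = Lim F (\<lambda>n. emeasure (\<alpha> k n) E)" for E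
      by (rule Lim_eq) (auto simp: eventually_sequentially step intro!: exI[of _ "nat (1 - k)"])
    ultimately show "vague_limit T F (\<alpha> k) (conv \<rho> (\<Lambda> (k - 1)))" by (simp add: vague_limit_def)
  qed (intro \<Lambda> radon_subprob_conv \<rho>)+
  moreover have "emeasure (\<Lambda> 0) (carrier G) \<noteq> 0"
  proof -
    have "a \<le> emeasure (\<alpha> 0 n) C" for n
      using x emeasure_conv_return[OF radon_subprob_conv_power[OF \<rho>] _ compactin_sets_borel_of[OF Hausdorff C(1)]]
      by (simp add: \<alpha>_def less_imp_le flip: r_coset_eq[OF Cc])
    then have "a \<le> Lim F (\<lambda>n. emeasure (\<alpha> 0 n) C)"
      using Lim_mono[of "\<lambda>n. a"] by (simp add: Lim_const)
    also have "\<dots> \<le> emeasure (\<Lambda> 0) C" using \<Lambda>(2) C(1) by (simp add: vague_limit_def)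
    also have "\<dots> \<le> emeasure (\<Lambda> 0) (carrier G)"
      using Cc carrier_sets by (intro emeasure_mono) (auto simp: radon_subprob_sets[OF \<Lambda>(1)])
    finally show ?thesis using a(1) by auto
  qed
  ultimately show ?thesis using \<Lambda>(1) unfolding invariant_chain_def by blast
qed

end

section \<open>The semidirect product\<close>

text \<open>
  The parameter \<open>p\<close> is locally constant.
\<close>

lemma continuous_map_discrete_parameter:
  assumes p: "continuous_map X (discrete_topology UNIV) p" and g: "\<And>n. continuous_map X Y (g n)"
  shows "continuous_map X Y (\<lambda>x. g (p x) x)"
  unfolding continuous_map_def
proof (intro conjI allI impI)
  show "(\<lambda>x. g (p x) x) \<in> topspace X \<rightarrow> topspace Y"
    using g by (auto simp: continuous_map_def)
  fix U assume U: "openin Y U"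
  have "openin X ({x \<in> topspace X. p x \<in> {n}} \<inter> {x \<in> topspace X. g n x \<in> U})" for n
    by (intro openin_Int openin_continuous_map_preimage[OF p] openin_continuous_map_preimage[OF g U]) simp
  then have "openin X (\<Union>n. {x \<in> topspace X. p x \<in> {n}} \<inter> {x \<in> topspace X. g n x \<in> U})"
    by blast
  moreover have "(\<Union>n. {x \<in> topspace X. p x \<in> {n}} \<inter> {x \<in> topspace X. g n x \<in> U}) =
      {x \<in> topspace X. g (p x) x \<in> U}" by auto
  ultimately show "openin X {x \<in> topspace X. g (p x) x \<in> U}" by simp
qed

locale automorphic_group = locally_compact_group G T for G (structure) and T +
  fixes \<phi> :: "'a \<Rightarrow> 'a"
  assumes automorphism: "topological_automorphism G T \<phi>"
begin

abbreviation \<psi> :: "'a \<Rightarrow> 'a" where "\<psi> \<equiv> inv_into (carrier G) \<phi>"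
abbreviation aut_pow :: "int \<Rightarrow> 'a \<Rightarrow> 'a" where "aut_pow \<equiv> aut_power G \<phi>"

lemma phi_bij: "bij_betw \<phi> (carrier G) (carrier G)"
  using automorphism by (simp add: topological_automorphism_def iso_def)

lemma phi_hom: "x \<in> carrier G \<Longrightarrow> y \<in> carrier G \<Longrightarrow> \<phi> (x \<otimes> y) = \<phi> x \<otimes> \<phi> y"
  using automorphism by (simp add: topological_automorphism_def iso_def hom_def)

lemma phi_closed: "x \<in> carrier G \<Longrightarrow> \<phi> x \<in> carrier G"
  using phi_bij bij_betwE by blast

lemma psi_closed: "x \<in> carrier G \<Longrightarrow> \<psi> x \<in> carrier G"
  using bij_betw_inv_into[OF phi_bij] bij_betwE by blast

lemma phi_psi: "x \<in> carrier G \<Longrightarrow> \<phi> (\<psi> x) = x"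
  by (rule bij_betw_inv_into_right[OF phi_bij])

lemma psi_phi: "x \<in> carrier G \<Longrightarrow> \<psi> (\<phi> x) = x"
  by (rule bij_betw_inv_into_left[OF phi_bij])

lemma psi_hom: "x \<in> carrier G \<Longrightarrow> y \<in> carrier G \<Longrightarrow> \<psi> (x \<otimes> y) = \<psi> x \<otimes> \<psi> y"
  using phi_hom[of "\<psi> x" "\<psi> y"] psi_phi[of "\<psi> x \<otimes> \<psi> y"] by (simp add: psi_closed phi_psi)

lemma phi_continuous: "continuous_map T T \<phi>"
  using automorphism by (simp add: topological_automorphism_def homeomorphic_imp_continuous_map)

lemma psi_continuous: "continuous_map T T \<psi>"
proof -
  have "homeomorphic_map T T \<phi>" using automorphism by (simp add: topological_automorphism_def)
  then obtain g where g: "homeomorphic_maps T T \<phi> g" by (auto simp: homeomorphic_map_maps)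
  have "g x = \<psi> x" if x: "x \<in> topspace T" for x
  proof -
    have "g x \<in> carrier G" "\<phi> (g x) = x"
      using g x by (auto simp: homeomorphic_maps_def continuous_map_def topspace_eq)
    then show ?thesis using psi_phi[of "g x"] by simp
  qed
  moreover have "continuous_map T T g" using g by (simp add: homeomorphic_maps_def)
  ultimately show ?thesis by (rule continuous_map_eq[rotated])
qed

lemma aut_pow_0 [simp]: "aut_pow 0 x = x"
  by (simp add: aut_power_def)

lemma aut_pow_closed: "x \<in> carrier G \<Longrightarrow> aut_pow n x \<in> carrier G"
proof -
  assume x: "x \<in> carrier G"
  have "(\<phi> ^^ k) x \<in> carrier G" "(\<psi> ^^ k) x \<in> carrier G" for k
    by (induction k) (auto simp: x phi_closed psi_closed)
  then show ?thesis by (simp add: aut_power_def)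
qed

lemma aut_pow_Suc:
  assumes x: "x \<in> carrier G" shows "aut_pow (n + 1) x = \<phi> (aut_pow n x)"
proof (cases "0 \<le> n")
  case True
  then have "nat (n + 1) = Suc (nat n)" by simp
  then show ?thesis using True by (simp add: aut_power_def)
next
  case False
  define k where "k = nat (- (n + 1))"
  have k: "nat (- n) = Suc k" using False by (simp add: k_def)
  have "aut_pow (n + 1) x = (\<psi> ^^ k) x"
  proof (cases "0 \<le> n + 1")
    case True
    with False have "n = -1" by simp
    then show ?thesis by (simp add: k_def aut_power_def)
  next
    case False
    then show ?thesis by (simp add: k_def aut_power_def)
  qed
  moreover have "(\<psi> ^^ k) x \<in> carrier G" by (induction k) (auto simp: x psi_closed)
  moreover have "aut_pow n x = \<psi> ((\<psi> ^^ k) x)" using False k by (simp add: aut_power_def)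
  ultimately show ?thesis by (simp add: phi_psi)
qed

lemma aut_pow_pred:
  assumes x: "x \<in> carrier G" shows "aut_pow (n - 1) x = \<psi> (aut_pow n x)"
  using aut_pow_Suc[OF x, of "n - 1"] psi_phi[OF aut_pow_closed[OF x]] by simp

lemma aut_pow_add:
  assumes x: "x \<in> carrier G" shows "aut_pow (n + m) x = aut_pow n (aut_pow m x)"
proof (induction n rule: int_induct[where k = 0])
  case base
  show ?case by simp
next
  case (step1 i)
  then show ?case
    using aut_pow_Suc[OF x, of "i + m"] aut_pow_Suc[OF aut_pow_closed[OF x], of i m] by (simp add: algebra_simps)
next
  case (step2 i)
  then show ?case
    using aut_pow_pred[OF x, of "i + m"] aut_pow_pred[OF aut_pow_closed[OF x], of i m] by (simp add: algebra_simps)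
qed

lemma aut_pow_mult:
  assumes x: "x \<in> carrier G" and y: "y \<in> carrier G" shows "aut_pow n (x \<otimes> y) = aut_pow n x \<otimes> aut_pow n y"
proof (induction n rule: int_induct[where k = 0])
  case base
  show ?case by simp
next
  case (step1 i)
  then show ?case using x y by (simp add: aut_pow_Suc phi_hom aut_pow_closed)
next
  case (step2 i)
  then show ?case using x y by (simp add: aut_pow_pred psi_hom aut_pow_closed)
qed

lemma aut_pow_one: "aut_pow n \<one> = \<one>"
  using aut_pow_mult[OF one_closed one_closed, of n] aut_pow_closed[OF one_closed, of n]
  by (metis l_one one_closed r_cancel_one')

lemma aut_pow_continuous: "continuous_map T T (aut_pow n)"
proof (induction n rule: int_induct[where k = 0])
  case base
  show ?case by (rule continuous_map_eq[OF continuous_map_id]) simp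
next
  case (step1 i)
  show ?case
    by (rule continuous_map_eq[OF continuous_map_compose[OF step1(2) phi_continuous]])
      (simp add: aut_pow_Suc topspace_eq)
next
  case (step2 i)
  show ?case
    by (rule continuous_map_eq[OF continuous_map_compose[OF step2(2) psi_continuous]])
      (simp add: aut_pow_pred topspace_eq)
qed

abbreviation H :: "(int \<times> 'a) monoid" where "H \<equiv> Z_semidirect G \<phi>"
abbreviation S :: "(int \<times> 'a) topology" where "S \<equiv> Z_semidirect_topology T"

lemma carrier_H: "carrier H = UNIV \<times> carrier G"
  by (simp add: Z_semidirect_def)

lemma mult_H: "(n, g) \<otimes>\<^bsub>H\<^esub> (m, h) = (n + m, g \<otimes> aut_pow n h)"
  by (simp add: Z_semidirect_def)

lemma one_H: "\<one>\<^bsub>H\<^esub> = (0, \<one>)"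
  by (simp add: Z_semidirect_def)

lemma inverse_H:
  assumes "g \<in> carrier G"
  shows "(- n, aut_pow (- n) (inv g)) \<otimes>\<^bsub>H\<^esub> (n, g) = \<one>\<^bsub>H\<^esub>"
  using assms by (simp add: mult_H one_H aut_pow_mult[symmetric] aut_pow_one)

lemma group_H: "group H"
proof (rule groupI)
  show "x \<otimes>\<^bsub>H\<^esub> y \<in> carrier H" if "x \<in> carrier H" "y \<in> carrier H" for x y
    using that by (cases x; cases y) (auto simp: mult_H carrier_H aut_pow_closed)
  show "\<one>\<^bsub>H\<^esub> \<in> carrier H" by (simp add: one_H carrier_H)
  show "x \<otimes>\<^bsub>H\<^esub> y \<otimes>\<^bsub>H\<^esub> z = x \<otimes>\<^bsub>H\<^esub> (y \<otimes>\<^bsub>H\<^esub> z)"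
    if "x \<in> carrier H" "y \<in> carrier H" "z \<in> carrier H" for x y z
    using that by (cases x; cases y; cases z) (auto simp: mult_H carrier_H aut_pow_closed aut_pow_add aut_pow_mult m_assoc)
  show "\<one>\<^bsub>H\<^esub> \<otimes>\<^bsub>H\<^esub> x = x" if "x \<in> carrier H" for x
    using that by (cases x) (auto simp: mult_H carrier_H one_H)
  show "\<exists>y\<in>carrier H. y \<otimes>\<^bsub>H\<^esub> x = \<one>\<^bsub>H\<^esub>" if "x \<in> carrier H" for x
  proof (cases x)
    case (Pair n g)
    with that have g: "g \<in> carrier G" by (simp add: carrier_H)
    have "(- n, aut_pow (- n) (inv g)) \<in> carrier H" by (simp add: carrier_H aut_pow_closed g)
    with inverse_H[OF g, of n] show ?thesis unfolding Pair by blast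
  qed
qed

lemma inv_H:
  assumes g: "g \<in> carrier G" shows "inv\<^bsub>H\<^esub> (n, g) = (- n, aut_pow (- n) (inv g))"
  by (rule group.inv_equality[OF group_H inverse_H[OF g]]) (auto simp: carrier_H g aut_pow_closed)

lemma topspace_S: "topspace S = UNIV \<times> carrier G"
  by (simp add: Z_semidirect_topology_def topspace_eq)

lemma continuous_fst_S: "continuous_map S (discrete_topology UNIV) fst"
  unfolding Z_semidirect_topology_def by (rule continuous_map_fst)

lemma continuous_snd_S: "continuous_map S T snd"
  unfolding Z_semidirect_topology_def by (rule continuous_map_snd)

lemma continuous_into_S:
  assumes "continuous_map X (discrete_topology UNIV) (\<lambda>x. fst (f x))" "continuous_map X T (\<lambda>x. snd (f x))"
  shows "continuous_map X S f"
  using assms by (simp add: Z_semidirect_topology_def continuous_map_pairwise o_def)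

lemma continuous_map_mult:
  assumes "continuous_map X T f" "continuous_map X T g"
  shows "continuous_map X T (\<lambda>x. f x \<otimes> g x)"
proof -
  have "continuous_map X (prod_topology T T) (\<lambda>x. (f x, g x))"
    using assms by (simp add: continuous_map_pairwise o_def)
  from continuous_map_compose[OF this continuous_mult] show ?thesis by (simp add: o_def)
qed

lemma continuous_discrete_op:
  assumes "continuous_map X (discrete_topology UNIV) f" "continuous_map X (discrete_topology UNIV) g"
  shows "continuous_map X (discrete_topology UNIV) (\<lambda>x. h (f x) (g x))"
proof -
  have "continuous_map X (discrete_topology UNIV) (\<lambda>x. h n (g x))" for n
    using continuous_map_compose[OF assms(2), of "discrete_topology UNIV" "h n"] by (simp add: o_def)
  then show ?thesis by (rule continuous_map_discrete_parameter[OF assms(1), of _ "\<lambda>n x. h n (g x)"])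
qed

lemma locally_compact_group_H: "locally_compact_group H S"
proof (intro locally_compact_group.intro locally_compact_group_axioms.intro group_H)
  show "topspace S = carrier H" by (simp add: topspace_S carrier_H)
  let ?SS = "prod_topology S S"
  have f: "continuous_map ?SS S fst" and s: "continuous_map ?SS S snd"
    by (rule continuous_map_fst continuous_map_snd)+
  have ff: "continuous_map ?SS (discrete_topology UNIV) (\<lambda>z. fst (fst z))"
    and fs: "continuous_map ?SS (discrete_topology UNIV) (\<lambda>z. fst (snd z))"
    and sf: "continuous_map ?SS T (\<lambda>z. snd (fst z))"
    and ss: "continuous_map ?SS T (\<lambda>z. snd (snd z))"
    using continuous_map_compose[OF f continuous_fst_S] continuous_map_compose[OF s continuous_fst_S]
      continuous_map_compose[OF f continuous_snd_S] continuous_map_compose[OF s continuous_snd_S]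
    by (simp_all add: o_def)
  have "continuous_map ?SS T (\<lambda>z. snd (fst z) \<otimes> aut_pow (fst (fst z)) (snd (snd z)))"
  proof (rule continuous_map_discrete_parameter[OF ff, of _ "\<lambda>n z. snd (fst z) \<otimes> aut_pow n (snd (snd z))"])
    show "continuous_map ?SS T (\<lambda>z. snd (fst z) \<otimes> aut_pow n (snd (snd z)))" for n
      using continuous_map_mult[OF sf] continuous_map_compose[OF ss aut_pow_continuous] by (simp add: o_def)
  qed
  then have "continuous_map ?SS S (\<lambda>z. (fst (fst z) + fst (snd z), snd (fst z) \<otimes> aut_pow (fst (fst z)) (snd (snd z))))"
    using continuous_discrete_op[OF ff fs, of "(+)"] by (intro continuous_into_S) simp_all
  moreover have "(\<lambda>z. (fst (fst z) + fst (snd z), snd (fst z) \<otimes> aut_pow (fst (fst z)) (snd (snd z)))) =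
      (\<lambda>(x, y). x \<otimes>\<^bsub>H\<^esub> y)"
    by (auto simp: mult_H fun_eq_iff)
  ultimately show "continuous_map ?SS S (\<lambda>(x, y). x \<otimes>\<^bsub>H\<^esub> y)" by simp
  have neg: "continuous_map S (discrete_topology UNIV) (\<lambda>x. - fst x)"
    using continuous_discrete_op[OF continuous_fst_S continuous_fst_S, of "\<lambda>n m. - n"] by simp
  have "continuous_map S T (\<lambda>x. aut_pow (- fst x) (inv (snd x)))"
  proof (rule continuous_map_discrete_parameter[OF neg, of _ "\<lambda>n x. aut_pow n (inv (snd x))"])
    show "continuous_map S T (\<lambda>x. aut_pow n (inv (snd x)))" for n
      using continuous_map_compose[OF continuous_map_compose[OF continuous_snd_S continuous_inv] aut_pow_continuous]
      by (simp add: o_def)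
  qed
  with neg have "continuous_map S S (\<lambda>x. (- fst x, aut_pow (- fst x) (inv (snd x))))"
    by (intro continuous_into_S) simp_all
  then show "continuous_map S S (\<lambda>x. inv\<^bsub>H\<^esub> x)"
    by (rule continuous_map_eq) (auto simp: topspace_S inv_H)
  show "Hausdorff_space S"
    unfolding Z_semidirect_topology_def using Hausdorff by (simp add: Hausdorff_space_prod_topology)
  show "locally_compact_space S"
    unfolding Z_semidirect_topology_def using locally_compact
    by (simp add: locally_compact_space_prod_topology locally_compact_space_discrete_topology)
qed

sublocale H: locally_compact_group H S
  by (rule locally_compact_group_H)

section \<open>Levels of the semidirect product\<close>

text \<open>
  The first factor is countable and discrete: an open set is the countable union of its
  levels, each of which is a measurable rectangle.
\<close>

lemma sets_borel_S: "sets (borel_of S) = sets (count_space UNIV \<Otimes>\<^sub>M borel_of T)"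
proof
  let ?P = "count_space UNIV \<Otimes>\<^sub>M borel_of T :: (int \<times> 'a) measure"
  have spP: "space ?P = topspace S" by (simp add: space_pair_measure topspace_S topspace_eq)
  have f: "fst \<in> borel_of S \<rightarrow>\<^sub>M count_space UNIV"
  proof (rule measurable_count_space_eq2_countable[THEN iffD2])
    show "fst \<in> space (borel_of S) \<rightarrow> UNIV \<and> (\<forall>n\<in>UNIV. fst -` {n} \<inter> space (borel_of S) \<in> sets (borel_of S))"
    proof (intro conjI ballI)
      fix n :: int
      have "openin S {x \<in> topspace S. fst x \<in> {n}}"
        by (rule openin_continuous_map_preimage[OF continuous_fst_S]) simp
      moreover have "fst -` {n} \<inter> space (borel_of S) = {x \<in> topspace S. fst x \<in> {n}}" by auto
      ultimately show "fst -` {n} \<inter> space (borel_of S) \<in> sets (borel_of S)"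
        by (simp add: openin_sets_borel_of)
    qed simp
  qed
  have s: "snd \<in> borel_of S \<rightarrow>\<^sub>M borel_of T"
    by (rule continuous_map_measurable_borel_of[OF continuous_snd_S])
  have id: "(\<lambda>x. (fst x, snd x)) \<in> borel_of S \<rightarrow>\<^sub>M ?P" by (rule measurable_Pair[OF f s])
  show "sets ?P \<subseteq> sets (borel_of S)"
  proof
    fix E assume E: "E \<in> sets ?P"
    have "E \<subseteq> topspace S" using sets.sets_into_space[OF E] spP by simp
    with measurable_sets[OF id E] show "E \<in> sets (borel_of S)" by (simp add: Int_absorb2)
  qed
  show "sets (borel_of S) \<subseteq> sets ?P"
    unfolding sets_borel_of[of S] spP[symmetric]
  proof (rule sets.sigma_sets_subset, safe)
    fix W assume W: "openin S W"
    have "openin T {g \<in> topspace T. (n, g) \<in> W}" for n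
      by (rule openin_continuous_map_preimage[OF continuous_into_S W]) simp_all
    then have "(\<Union>n. {n} \<times> {g \<in> topspace T. (n, g) \<in> W}) \<in> sets ?P"
      by (intro sets.countable_UN'') (auto intro!: pair_measureI openin_sets_borel_of)
    moreover have "(\<Union>n. {n} \<times> {g \<in> topspace T. (n, g) \<in> W}) = W"
      using openin_subset[OF W] by (auto simp: topspace_S topspace_eq)
    ultimately show "W \<in> sets ?P" by simp
  qed
qed

lemma level_sets: "E \<in> sets (borel_of T) \<Longrightarrow> {n} \<times> E \<in> sets (borel_of S)"
  unfolding sets_borel_S by (rule pair_measureI) auto

definition at_level :: "int \<Rightarrow> 'a measure \<Rightarrow> (int \<times> 'a) measure" where
  "at_level n \<alpha> = distr \<alpha> (borel_of S) (Pair n)"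

text \<open>
  The restriction to the level \<open>{n} \<times> G\<close>, viewed as a measure on \<open>G\<close>. It is written as the
  image of a density so that integrals against it are available at once.
\<close>

definition slice :: "int \<Rightarrow> (int \<times> 'a) measure \<Rightarrow> 'a measure" where
  "slice n \<nu> = distr (density \<nu> (indicator ({n} \<times> carrier G))) (borel_of T) snd"

lemma continuous_Pair: "continuous_map T S (Pair n)"
  by (rule continuous_into_S) simp_all

lemma sets_at_level [simp]: "sets (at_level n \<alpha>) = sets (borel_of S)"
  by (simp add: at_level_def)

lemma sets_slice [simp]: "sets (slice n \<nu>) = sets (borel_of T)"
  by (simp add: slice_def)

lemma emeasure_at_level:
  assumes \<alpha>: "sets \<alpha> = sets (borel_of T)" and E: "E \<in> sets (borel_of S)"
  shows "emeasure (at_level n \<alpha>) E = emeasure \<alpha> {g \<in> carrier G. (n, g) \<in> E}"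
proof -
  have "Pair n \<in> \<alpha> \<rightarrow>\<^sub>M borel_of S"
    using continuous_map_measurable_borel_of[OF continuous_Pair] measurable_cong_sets[OF \<alpha> refl] by blast
  moreover have "space \<alpha> = carrier G" using sets_eq_imp_space_eq[OF \<alpha>] by (simp add: topspace_eq)
  ultimately show ?thesis
    using E by (simp add: at_level_def emeasure_distr vimage_def Int_def conj_commute)
qed

lemma nn_integral_slice:
  assumes \<nu>: "sets \<nu> = sets (borel_of S)" and f: "f \<in> borel_measurable (borel_of T)"
  shows "(\<integral>\<^sup>+g. f g \<partial>slice n \<nu>) = (\<integral>\<^sup>+x. indicator ({n} \<times> carrier G) x * f (snd x) \<partial>\<nu>)"
proof -
  have snd: "snd \<in> \<nu> \<rightarrow>\<^sub>M borel_of T"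
    using continuous_map_measurable_borel_of[OF continuous_snd_S] measurable_cong_sets[OF \<nu> refl] by blast
  have ind: "{n} \<times> carrier G \<in> sets \<nu>" using level_sets[OF carrier_sets] by (simp add: \<nu>)
  have "(\<integral>\<^sup>+g. f g \<partial>slice n \<nu>) = (\<integral>\<^sup>+x. f (snd x) \<partial>density \<nu> (indicator ({n} \<times> carrier G)))"
    unfolding slice_def using snd f by (intro nn_integral_distr) simp_all
  also have "\<dots> = (\<integral>\<^sup>+x. indicator ({n} \<times> carrier G) x * f (snd x) \<partial>\<nu>)"
    using ind measurable_compose[OF snd f] by (intro nn_integral_density) auto
  finally show ?thesis .
qed

lemma emeasure_slice:
  assumes \<nu>: "sets \<nu> = sets (borel_of S)" and E: "E \<in> sets (borel_of T)"
  shows "emeasure (slice n \<nu>) E = emeasure \<nu> ({n} \<times> E)"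
proof -
  have "emeasure (slice n \<nu>) E = (\<integral>\<^sup>+g. indicator E g \<partial>slice n \<nu>)" using E by simp
  also have "\<dots> = (\<integral>\<^sup>+x. indicator ({n} \<times> carrier G) x * indicator E (snd x) \<partial>\<nu>)"
    using E by (intro nn_integral_slice[OF \<nu>]) simp
  also have "\<dots> = (\<integral>\<^sup>+x. indicator ({n} \<times> E) x \<partial>\<nu>)"
    using sets.sets_into_space[OF E]
    by (intro nn_integral_cong) (auto simp: indicator_def topspace_eq)
  also have "\<dots> = emeasure \<nu> ({n} \<times> E)" using level_sets[OF E] by (simp add: \<nu>)
  finally show ?thesis .
qed

lemma emeasure_slice_at_level:
  assumes \<alpha>: "sets \<alpha> = sets (borel_of T)" and E: "E \<in> sets (borel_of T)"
  shows "emeasure (slice m (at_level n \<alpha>)) E = (if m = n then emeasure \<alpha> E else 0)"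
proof -
  have "emeasure (slice m (at_level n \<alpha>)) E = emeasure \<alpha> {g \<in> carrier G. (n, g) \<in> {m} \<times> E}"
    by (simp add: emeasure_slice[OF _ E] emeasure_at_level[OF \<alpha> level_sets[OF E]])
  moreover have "{g \<in> carrier G. (n, g) \<in> {m} \<times> E} = (if m = n then E else {})"
    using sets.sets_into_space[OF E] by (auto simp: topspace_eq)
  ultimately show ?thesis by simp
qed

lemma slice_at_level_same:
  assumes \<alpha>: "sets \<alpha> = sets (borel_of T)"
  shows "slice n (at_level n \<alpha>) = \<alpha>"
  by (rule measure_eqI) (simp_all add: \<alpha> emeasure_slice_at_level)

lemma emeasure_eq_sum_slices:
  assumes \<nu>: "sets \<nu> = sets (borel_of S)" and E: "E \<in> sets (borel_of S)"
  shows "emeasure \<nu> E = (\<integral>\<^sup>+n. emeasure (slice n \<nu>) {g \<in> carrier G. (n, g) \<in> E} \<partial>count_space UNIV)"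
proof -
  have sets: "{g \<in> carrier G. (n, g) \<in> E} \<in> sets (borel_of T)" for n
    using measurable_sets[OF continuous_map_measurable_borel_of[OF continuous_Pair] E, of n]
    by (simp add: vimage_def Int_def conj_commute topspace_eq)
  have eq: "E = (\<Union>n\<in>UNIV. {n} \<times> {g \<in> carrier G. (n, g) \<in> E})"
    using sets.sets_into_space[OF E] by (auto simp: topspace_S)
  have "emeasure \<nu> (\<Union>n\<in>UNIV. {n} \<times> {g \<in> carrier G. (n, g) \<in> E}) =
      (\<integral>\<^sup>+n. emeasure \<nu> ({n} \<times> {g \<in> carrier G. (n, g) \<in> E}) \<partial>count_space UNIV)"
    using level_sets[OF sets] by (intro emeasure_UN_countable) (auto simp: \<nu> disjoint_family_on_def)
  then show ?thesis unfolding eq[symmetric] by (simp add: emeasure_slice[OF \<nu> sets])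
qed

lemma eq_if_slices_eq:
  assumes "sets \<nu> = sets (borel_of S)" "sets \<nu>' = sets (borel_of S)" "\<And>n. slice n \<nu> = slice n \<nu>'"
  shows "\<nu> = \<nu>'"
  by (rule measure_eqI) (simp_all add: assms emeasure_eq_sum_slices)

lemma radon_subprob_at_level:
  assumes \<alpha>: "radon_subprob T \<alpha>" shows "radon_subprob S (at_level n \<alpha>)"
proof (rule radon_subprobI)
  note sets\<alpha> = radon_subprob_sets[OF \<alpha>]
  show "sets (at_level n \<alpha>) = sets (borel_of S)" by simp
  show "emeasure (at_level n \<alpha>) (topspace S) \<le> 1"
    using emeasure_at_level[OF sets\<alpha> H.carrier_sets] radon_subprob_le_1[OF \<alpha>] by (simp add: topspace_S carrier_H)
  fix U and e :: real assume U: "openin S U" and "0 < e"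
  have "openin T {g \<in> topspace T. (n, g) \<in> U}"
    by (rule openin_continuous_map_preimage[OF continuous_Pair U])
  then obtain K where K: "compactin T K" "K \<subseteq> {g \<in> topspace T. (n, g) \<in> U}"
    "emeasure \<alpha> {g \<in> topspace T. (n, g) \<in> U} \<le> emeasure \<alpha> K + ennreal e"
    using radon_subprob_open_approx[OF \<alpha> _ \<open>0 < e\<close>] by blast
  have cK: "compactin S (Pair n ` K)" by (rule image_compactin[OF K(1) continuous_Pair])
  moreover have "Pair n ` K \<subseteq> U" using K(2) by auto
  moreover have "{g \<in> carrier G. (n, g) \<in> Pair n ` K} = K"
    using compactin_subset_topspace[OF K(1)] by (auto simp: topspace_eq)
  ultimately show "\<exists>K. compactin S K \<and> K \<subseteq> U \<and> emeasure (at_level n \<alpha>) U \<le> emeasure (at_level n \<alpha>) K + ennreal e"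
    using K(3) emeasure_at_level[OF sets\<alpha> openin_sets_borel_of[OF U]]
      emeasure_at_level[OF sets\<alpha> compactin_sets_borel_of[OF H.Hausdorff cK]]
    by (intro exI[of _ "Pair n ` K"]) (simp add: topspace_eq)
qed

lemma radon_subprob_slice:
  assumes \<nu>: "radon_subprob S \<nu>" shows "radon_subprob T (slice n \<nu>)"
proof (rule radon_subprobI)
  note sets\<nu> = radon_subprob_sets[OF \<nu>]
  show "sets (slice n \<nu>) = sets (borel_of T)" by simp
  show "emeasure (slice n \<nu>) (topspace T) \<le> 1"
    by (simp add: topspace_eq emeasure_slice[OF sets\<nu> carrier_sets] radon_subprob_le_1[OF \<nu>])
  fix U and e :: real assume U: "openin T U" and "0 < e"
  have "openin S ({n} \<times> U)" unfolding Z_semidirect_topology_def using U by (simp add: openin_prod_Times_iff)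
  then obtain K where K: "compactin S K" "K \<subseteq> {n} \<times> U" "emeasure \<nu> ({n} \<times> U) \<le> emeasure \<nu> K + ennreal e"
    using radon_subprob_open_approx[OF \<nu> _ \<open>0 < e\<close>] by blast
  have cK: "compactin T (snd ` K)" by (rule image_compactin[OF K(1) continuous_snd_S])
  note sK = compactin_sets_borel_of[OF Hausdorff cK]
  have "emeasure \<nu> K \<le> emeasure \<nu> ({n} \<times> snd ` K)"
    using K(2) level_sets[OF sK] by (intro emeasure_mono) (force simp: sets\<nu>)+
  then have "emeasure (slice n \<nu>) U \<le> emeasure (slice n \<nu>) (snd ` K) + ennreal e"
    using K(3) by (simp add: emeasure_slice[OF sets\<nu>] sK openin_sets_borel_of[OF U])
      (meson add_right_mono order_trans)
  then show "\<exists>K. compactin T K \<and> K \<subseteq> U \<and> emeasure (slice n \<nu>) U \<le> emeasure (slice n \<nu>) K + ennreal e"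
    using cK K(2) by (intro exI[of _ "snd ` K"]) force
qed

text \<open>
  Left multiplication by \<open>(1, g)\<close> takes the point \<open>(n, h)\<close> to \<open>(n + 1, g \<phi>(h))\<close>: convolution
  by \<open>\<rho>\<close> lifts each level to the next one and acts there as one step of the equation on \<open>G\<close>.
\<close>

lemma slice_conv:
  assumes \<mu>: "radon_subprob T \<mu>" and \<nu>: "sets \<nu> = sets (borel_of S)"
  shows "slice (n + 1) (H.conv (at_level 1 \<mu>) \<nu>) = conv \<mu> (distr (slice n \<nu>) (borel_of T) \<phi>)"
proof (rule measure_eqI)
  fix E assume "E \<in> sets (slice (n + 1) (H.conv (at_level 1 \<mu>) \<nu>))"
  then have E: "E \<in> sets (borel_of T)" by simp
  have Ec: "E \<subseteq> carrier G" using sets.sets_into_space[OF E] by (simp add: topspace_eq)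
  have \<phi>m: "\<phi> \<in> borel_of T \<rightarrow>\<^sub>M borel_of T" by (rule continuous_map_measurable_borel_of[OF phi_continuous])
  then have \<phi>m': "\<phi> \<in> slice n \<nu> \<rightarrow>\<^sub>M borel_of T"
    using measurable_cong_sets[OF sets_slice refl] by blast
  note meas = measurable_emeasure_translate[OF \<mu> E]
  have space\<nu>: "space \<nu> = UNIV \<times> carrier G" using sets_eq_imp_space_eq[OF \<nu>] by (simp add: topspace_S)
  have "emeasure (slice (n + 1) (H.conv (at_level 1 \<mu>) \<nu>)) E =
      (\<integral>\<^sup>+x. emeasure (at_level 1 \<mu>) (H.translate_preimage ({n + 1} \<times> E) x) \<partial>\<nu>)"
    by (simp add: emeasure_slice[OF _ E] H.emeasure_conv[OF radon_subprob_at_level[OF \<mu>] \<nu> level_sets[OF E]])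
  also have "\<dots> = (\<integral>\<^sup>+x. indicator ({n} \<times> carrier G) x *
      emeasure \<mu> (translate_preimage E (\<phi> (snd x))) \<partial>\<nu>)"
  proof (rule nn_integral_cong)
    fix x assume "x \<in> space \<nu>"
    then obtain j h where x: "x = (j, h)" "h \<in> carrier G" by (auto simp: space\<nu>)
    then have xH: "x \<in> carrier H" by (simp add: carrier_H)
    have pow1: "aut_pow 1 h = \<phi> h" using aut_pow_Suc[OF x(2), of 0] by simp
    have "emeasure (at_level 1 \<mu>) (H.translate_preimage ({n + 1} \<times> E) x) =
        emeasure \<mu> {g \<in> carrier G. (1, g) \<in> H.translate_preimage ({n + 1} \<times> E) x}"
      by (rule emeasure_at_level[OF radon_subprob_sets[OF \<mu>] H.translate_preimage_sets[OF level_sets[OF E] xH]])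
    also have "{g \<in> carrier G. (1, g) \<in> H.translate_preimage ({n + 1} \<times> E) x} =
        (if j = n then translate_preimage E (\<phi> h) else {})"
      by (auto simp: x carrier_H mult_H pow1)
    also have "emeasure \<mu> \<dots> = indicator ({n} \<times> carrier G) x * emeasure \<mu> (translate_preimage E (\<phi> (snd x)))"
      using x by simp
    finally show "emeasure (at_level 1 \<mu>) (H.translate_preimage ({n + 1} \<times> E) x) =
        indicator ({n} \<times> carrier G) x * emeasure \<mu> (translate_preimage E (\<phi> (snd x)))" .
  qed
  also have "\<dots> = (\<integral>\<^sup>+h. emeasure \<mu> (translate_preimage E (\<phi> h)) \<partial>slice n \<nu>)"
    using nn_integral_slice[OF \<nu> measurable_compose[OF \<phi>m meas]] by simp
  also have "\<dots> = (\<integral>\<^sup>+z. emeasure \<mu> (translate_preimage E z) \<partial>distr (slice n \<nu>) (borel_of T) \<phi>)"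
    using meas by (intro nn_integral_distr[OF \<phi>m', symmetric]) simp
  also have "\<dots> = emeasure (conv \<mu> (distr (slice n \<nu>) (borel_of T) \<phi>)) E"
    using emeasure_conv[OF \<mu> _ E] by simp
  finally show "emeasure (slice (n + 1) (H.conv (at_level 1 \<mu>) \<nu>)) E =
      emeasure (conv \<mu> (distr (slice n \<nu>) (borel_of T) \<phi>)) E" .
qed simp

lemma one_tensor_eq_at_level:
  assumes \<mu>: "radon_subprob T \<mu>" shows "one_tensor \<mu> = at_level 1 \<mu>"
proof (rule measure_eqI)
  note sets\<mu> = radon_subprob_sets[OF \<mu>]
  interpret finite_measure \<mu> by (rule radon_subprob_finite[OF \<mu>])
  have sets: "sets (one_tensor \<mu>) = sets (borel_of S)"
    unfolding one_tensor_def sets_borel_S by (rule sets_pair_measure_cong) (simp_all add: sets\<mu>)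
  then show "sets (one_tensor \<mu>) = sets (at_level 1 \<mu>)" by simp
  fix E assume E: "E \<in> sets (one_tensor \<mu>)"
  then have E': "E \<in> sets (return (count_space UNIV) 1 \<Otimes>\<^sub>M \<mu>)" by (simp add: one_tensor_def)
  have "emeasure (one_tensor \<mu>) E = (\<integral>\<^sup>+n. emeasure \<mu> (Pair n -` E) \<partial>return (count_space UNIV) 1)"
    unfolding one_tensor_def by (rule emeasure_pair_measure_alt[OF E'])
  also have "\<dots> = emeasure \<mu> (Pair 1 -` E)" by (simp add: nn_integral_return)
  also have "Pair 1 -` E = {g \<in> carrier G. (1, g) \<in> E}"
    using sets.sets_into_space[OF E[unfolded sets]] by (auto simp: topspace_S)
  also have "emeasure \<mu> \<dots> = emeasure (at_level 1 \<mu>) E"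
    using E emeasure_at_level[OF sets\<mu>] by (simp add: sets)
  finally show "emeasure (one_tensor \<mu>) E = emeasure (at_level 1 \<mu>) E" .
qed

section \<open>Solutions and invariant chains\<close>

lemma emeasure_conv_distr_phi_carrier:
  assumes \<mu>: "radon_subprob T \<mu>" "emeasure \<mu> (carrier G) = 1" and \<beta>: "sets \<beta> = sets (borel_of T)"
  shows "emeasure (conv \<mu> (distr \<beta> (borel_of T) \<phi>)) (carrier G) = emeasure \<beta> (carrier G)"
proof -
  have sp: "space \<beta> = carrier G" using sets_eq_imp_space_eq[OF \<beta>] by (simp add: topspace_eq)
  have "\<phi> \<in> \<beta> \<rightarrow>\<^sub>M borel_of T"
    using continuous_map_measurable_borel_of[OF phi_continuous] measurable_cong_sets[OF \<beta> refl] by blast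
  moreover have "\<phi> -` carrier G \<inter> space \<beta> = carrier G" by (auto simp: sp phi_closed)
  ultimately show ?thesis
    by (simp add: emeasure_conv_carrier[OF \<mu>(1)] \<mu>(2) emeasure_distr carrier_sets)
qed

lemma conv_distr_scale_measure:
  assumes \<mu>: "radon_subprob T \<mu>" and \<beta>: "sets \<beta> = sets (borel_of T)"
  shows "conv \<mu> (distr (scale_measure r \<beta>) (borel_of T) \<phi>) =
    scale_measure r (conv \<mu> (distr \<beta> (borel_of T) \<phi>))"
proof -
  have \<phi>m: "\<phi> \<in> \<beta> \<rightarrow>\<^sub>M borel_of T"
    using continuous_map_measurable_borel_of[OF phi_continuous] measurable_cong_sets[OF \<beta> refl] by blast
  then have \<phi>m': "\<phi> \<in> scale_measure r \<beta> \<rightarrow>\<^sub>M borel_of T"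
    using measurable_cong_sets[OF sets_scale_measure refl] by blast
  have distr: "distr (scale_measure r \<beta>) (borel_of T) \<phi> = scale_measure r (distr \<beta> (borel_of T) \<phi>)"
    by (rule measure_eqI) (simp_all add: emeasure_distr[OF \<phi>m] emeasure_distr[OF \<phi>m'] space_scale_measure)
  show ?thesis
    unfolding distr
  proof (rule measure_eqI)
    fix E assume "E \<in> sets (conv \<mu> (scale_measure r (distr \<beta> (borel_of T) \<phi>)))"
    then have E: "E \<in> sets (borel_of T)" by simp
    have "(\<lambda>x. emeasure \<mu> (translate_preimage E x)) \<in> borel_measurable (distr \<beta> (borel_of T) \<phi>)"
      using measurable_emeasure_translate[OF \<mu> E] by simp
    then show "emeasure (conv \<mu> (scale_measure r (distr \<beta> (borel_of T) \<phi>))) E =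
        emeasure (scale_measure r (conv \<mu> (distr \<beta> (borel_of T) \<phi>))) E"
      by (simp add: emeasure_conv[OF \<mu> _ E] nn_integral_scale_measure)
  qed simp
qed

lemma radon_subprob_scale_measure:
  assumes N: "radon_subprob T N" and le: "r * emeasure N (carrier G) \<le> 1"
  shows "radon_subprob T (scale_measure r N)"
  unfolding radon_subprob_def
proof (safe)
  fix U assume "openin T U"
  then have "emeasure N U = (SUP K\<in>{K. compactin T K \<and> K \<subseteq> U}. emeasure N K)"
    using N by (simp add: radon_subprob_def)
  then show "emeasure (scale_measure r N) U =
      (SUP K\<in>{K. compactin T K \<and> K \<subseteq> U}. emeasure (scale_measure r N) K)"
    by (simp add: SUP_mult_left_ennreal)
qed (use le in \<open>simp_all add: radon_subprob_sets[OF N] topspace_eq\<close>)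

text \<open>
  Both sides of the equation live on the level \<open>k\<close> alone, and there it is the equation for
  \<open>\<Lambda>\<close>.
\<close>

lemma solution_imp_invariant_chain:
  assumes \<mu>: "radon_subprob T \<mu>" "emeasure \<mu> (carrier G) = 1" and sol: "is_solution G T \<phi> \<mu> \<Lambda>"
  shows "H.invariant_chain (at_level 1 \<mu>) (\<lambda>k. at_level k (\<Lambda> k))"
  unfolding H.invariant_chain_def
proof (intro conjI allI)
  have \<Lambda>: "radon_subprob T (\<Lambda> k)" "emeasure (\<Lambda> k) (carrier G) = 1" for k
    using sol regular_borel_prob_iff_radon_subprob[OF Hausdorff, of "\<Lambda> k"]
    unfolding is_solution_def topspace_eq by blast+
  have eq: "\<Lambda> k = conv \<mu> (distr (\<Lambda> (k - 1)) (borel_of T) \<phi>)" for k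
    using sol unfolding is_solution_def by blast
  note sets = radon_subprob_sets[OF \<Lambda>(1)]
  show "radon_subprob S (at_level k (\<Lambda> k))" for k by (rule radon_subprob_at_level[OF \<Lambda>(1)])
  show "emeasure (at_level 0 (\<Lambda> 0)) (carrier H) \<noteq> 0"
    using emeasure_at_level[OF sets H.carrier_sets] \<Lambda>(2) by (simp add: carrier_H)
  show "at_level k (\<Lambda> k) = H.conv (at_level 1 \<mu>) (at_level (k - 1) (\<Lambda> (k - 1)))" for k
  proof (rule eq_if_slices_eq)
    fix n
    have conv: "slice n (H.conv (at_level 1 \<mu>) (at_level (k - 1) (\<Lambda> (k - 1)))) =
        conv \<mu> (distr (slice (n - 1) (at_level (k - 1) (\<Lambda> (k - 1)))) (borel_of T) \<phi>)"
      using slice_conv[OF \<mu>(1) sets_at_level, of "n - 1"] by simp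
    show "slice n (at_level k (\<Lambda> k)) = slice n (H.conv (at_level 1 \<mu>) (at_level (k - 1) (\<Lambda> (k - 1))))"
    proof (cases "n = k")
      case True
      show ?thesis unfolding True conv[unfolded True] slice_at_level_same[OF sets] by (rule eq)
    next
      case False
      show ?thesis
      proof (rule measure_eqI)
        fix E assume "E \<in> sets (slice n (at_level k (\<Lambda> k)))"
        then have E: "E \<in> sets (borel_of T)" by simp
        let ?R = "slice n (H.conv (at_level 1 \<mu>) (at_level (k - 1) (\<Lambda> (k - 1))))"
        have "emeasure ?R E \<le> emeasure ?R (carrier G)"
          using sets.sets_into_space[OF E] carrier_sets by (intro emeasure_mono) (auto simp: topspace_eq)
        also have "\<dots> = 0"
          unfolding conv emeasure_conv_distr_phi_carrier[OF \<mu> sets_slice]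
          using False by (simp add: emeasure_slice_at_level[OF sets carrier_sets])
        finally show "emeasure (slice n (at_level k (\<Lambda> k))) E = emeasure ?R E"
          using False by (simp add: emeasure_slice_at_level[OF sets E])
      qed simp
    qed
  qed simp_all
qed

text \<open>
  Some level \<open>j\<close> carries mass at time 0. Following the levels \<open>k + j\<close> gives measures on \<open>G\<close>
  that solve the equation and all have the same mass, so they only have to be normalised.
\<close>

lemma invariant_chain_imp_solution:
  assumes \<mu>: "radon_subprob T \<mu>" "emeasure \<mu> (carrier G) = 1" and \<nu>: "H.invariant_chain (at_level 1 \<mu>) \<nu>"
  shows "\<exists>\<Lambda>. is_solution G T \<phi> \<mu> \<Lambda>"
proof -
  note \<nu>r = H.invariant_chainD(1)[OF \<nu>]
  note sets = radon_subprob_sets[OF \<nu>r]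
  have "\<exists>j. emeasure (slice j (\<nu> 0)) (carrier G) \<noteq> 0"
  proof (rule ccontr)
    assume "\<nexists>j. emeasure (slice j (\<nu> 0)) (carrier G) \<noteq> 0"
    then have "emeasure (\<nu> 0) (carrier H) = 0"
      unfolding emeasure_eq_sum_slices[OF sets H.carrier_sets] by (simp add: carrier_H)
    with H.invariant_chainD(3)[OF \<nu>] show False ..
  qed
  then obtain j where j: "emeasure (slice j (\<nu> 0)) (carrier G) \<noteq> 0" ..
  define N where "N k = slice (k + j) (\<nu> k)" for k
  have N: "radon_subprob T (N k)" for k unfolding N_def by (rule radon_subprob_slice[OF \<nu>r])
  have step: "N k = conv \<mu> (distr (N (k - 1)) (borel_of T) \<phi>)" for k
  proof -
    have "N k = slice (k - 1 + j + 1) (H.conv (at_level 1 \<mu>) (\<nu> (k - 1)))"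
      unfolding N_def using H.invariant_chainD(2)[OF \<nu>, of k] by simp
    then show ?thesis unfolding slice_conv[OF \<mu>(1) sets] N_def .
  qed
  have mass_step: "emeasure (N k) (carrier G) = emeasure (N (k - 1)) (carrier G)" for k
    by (subst step) (rule emeasure_conv_distr_phi_carrier[OF \<mu> radon_subprob_sets[OF N]])
  have mass: "emeasure (N k) (carrier G) = emeasure (N 0) (carrier G)" for k
  proof (induction k rule: int_induct[where k = 0])
    case (step1 i) then show ?case using mass_step[of "i + 1"] by simp
  next
    case (step2 i) then show ?case using mass_step[of i] by simp
  qed simp
  define t where "t = emeasure (N 0) (carrier G)"
  have t: "t \<noteq> 0" "t \<noteq> \<top>" using j radon_subprob_neq_top[OF N, of 0] by (simp_all add: t_def N_def)
  define \<Lambda> where "\<Lambda> k = scale_measure (inverse t) (N k)" for k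
  have total: "emeasure (\<Lambda> k) (carrier G) = 1" for k
    using t unfolding \<Lambda>_def emeasure_scale_measure mass[of k] t_def[symmetric]
    by (simp add: mult.commute[of "inverse t"] less_top flip: divide_ennreal_def)
  have \<Lambda>: "radon_subprob T (\<Lambda> k)" for k
    unfolding \<Lambda>_def using total[of k] by (intro radon_subprob_scale_measure N) (simp add: \<Lambda>_def)
  have "\<Lambda> k = conv \<mu> (distr (\<Lambda> (k - 1)) (borel_of T) \<phi>)" for k
    unfolding \<Lambda>_def conv_distr_scale_measure[OF \<mu>(1) radon_subprob_sets[OF N]] by (subst step) simp
  moreover have "regular_borel_prob T (\<Lambda> k)" for k
    using \<Lambda> total by (simp add: regular_borel_prob_iff_radon_subprob[OF Hausdorff] topspace_eq)
  ultimately have "is_solution G T \<phi> \<mu> \<Lambda>" unfolding is_solution_def by blast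
  then show ?thesis by blast
qed

end

theorem proposition3p1:
  fixes G :: "('a, 'b) monoid_scheme" and T :: "'a topology"
    and P :: "'w measure" and \<xi> :: "int \<Rightarrow> 'w \<Rightarrow> 'a"
    and \<mu> :: "'a measure" and \<phi> :: "'a \<Rightarrow> 'a"
  assumes "locally_compact_group G T"
    and "prob_space P"
    and "\<And>k. \<xi> k \<in> measurable P (borel_of T)"
    and "\<And>k. distr P (borel_of T) (\<xi> k) = \<mu>"
    and "regular_borel_prob T \<mu>"
    and "topological_automorphism G T \<phi>"
  shows "(\<exists>\<Lambda>. is_solution G T \<phi> \<mu> \<Lambda>) \<longleftrightarrow>
    \<not> dissipating (Z_semidirect G \<phi>) (Z_semidirect_topology T) (one_tensor \<mu>)"
proof -
  interpret automorphic_group G T \<phi>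
    by (intro automorphic_group.intro automorphic_group_axioms.intro assms)
  have \<mu>: "radon_subprob T \<mu>" "emeasure \<mu> (carrier G) = 1"
    using assms(5) regular_borel_prob_iff_radon_subprob[OF Hausdorff] by (auto simp: topspace_eq)
  show ?thesis
    unfolding one_tensor_eq_at_level[OF \<mu>(1)]
    using solution_imp_invariant_chain[OF \<mu>] invariant_chain_imp_solution[OF \<mu>]
      H.invariant_chain_imp_not_dissipating[OF radon_subprob_at_level[OF \<mu>(1)]]
      H.not_dissipating_imp_invariant_chain[OF radon_subprob_at_level[OF \<mu>(1)]]
    by blast
qed

end
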